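(* Let $n\ge 1$ be an integer. For every $a=(a_1,\dots,a_{n+1})\in\mathbb{R}^{n+1}$ with $\sum_{j=1}^{n+1}a_j=0$ and $\sum_{j=1}^{n+1}a_j^2=1$, $$\operatorname{vol}_{n-1}(\Delta_n\cap a^\perp)\le \frac{\sqrt{n+1}}{(n-1)!}\,\frac{1}{\sqrt2}.$$ Moreover, equality holds precisely for the hyperplanes $a^\perp$ containing $n-1$ vertices of $\Delta_n$, or equivalently precisely when $a$ is proportional, up to a permutation of coordinates, to $\frac1{\sqrt2}(1,-1,0,\dots,0)$.
   Context: $\Delta_n=\{x\in\mathbb{R}^{n+1}: x_j\ge 0 \text{ for all } j,\ \sum_{j=1}^{n+1}x_j=1\}$ is the regular $n$-simplex in its standard embedding; its vertices are the standard basis vectors of $\mathbb{R}^{n+1}$. For $a\in\mathbb{R}^{n+1}$, $a^\perp=\{x\in\mathbb{R}^{n+1}:\langle x,a\rangle=0\}$. $\operatorname{vol}_{n-1}$ denotes $(n-1)$-dimensional Lebesgue measure (equivalently, Hausdorff measure normalized so that unit cubes have volume $1$). *)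

theory Defs
  imports "HOL-Analysis.Analysis"
begin

definition regular_simplex :: "(real ^ 'm) set" where
  "regular_simplex = {x. (\<forall>j. 0 \<le> x $ j) \<and> (\<Sum>j\<in>UNIV. x $ j) = 1}"

definition regular_simplex_vertices :: "(real ^ 'm) set" where
  "regular_simplex_vertices = range (\<lambda>j. axis j 1)"

definition perp :: "'a::real_inner \<Rightarrow> 'a set" where
  "perp a = {x. x \<bullet> a = 0}"

definition orthonormal_family :: "nat \<Rightarrow> (nat \<Rightarrow> 'a::real_inner) \<Rightarrow> bool" where
  "orthonormal_family k b \<longleftrightarrow> (\<forall>i<k. \<forall>j<k. b i \<bullet> b j = (if i = j then 1 else 0))"

text \<open>Isometric coordinates on the k-dimensional affine subspace through p spanned by b.\<close>

definition flat_point :: "nat \<Rightarrow> 'a::real_vector \<Rightarrow> (nat \<Rightarrow> 'a) \<Rightarrow> (nat \<Rightarrow> real) \<Rightarrow> 'a" where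
  "flat_point k p b c = p + (\<Sum>i<k. c i *\<^sub>R b i)"

definition is_frame_for :: "nat \<Rightarrow> 'a::real_inner set \<Rightarrow> 'a \<times> (nat \<Rightarrow> 'a) \<Rightarrow> bool" where
  "is_frame_for k S F \<longleftrightarrow>
     orthonormal_family k (snd F) \<and> S \<subseteq> range (flat_point k (fst F) (snd F))"

text \<open>
  The k-dimensional Lebesgue measure of a (Borel) set S contained in some k-dimensional affine
  subspace: pull S back along isometric coordinates and take Lebesgue measure on the k-fold
  product of the real line. By isometry invariance of Lebesgue measure the value does not depend
  on the frame that is chosen. For k = 0 the product space is a single point of mass 1, so a
  singleton has volume 1. The value is unspecified if S lies in no k-dimensional affine subspace.
\<close>

definition vol :: "nat \<Rightarrow> 'a::real_inner set \<Rightarrow> ennreal" where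
  "vol k S =
     (let M = PiM {..<k} (\<lambda>_. lborel :: real measure);
          F = (SOME F. is_frame_for k S F)
      in emeasure M {c \<in> space M. flat_point k (fst F) (snd F) c \<in> S})"

end

theory Submission
  imports Defs "HOL-Probability.Distributions"
begin

text \<open>
  Up to the factor \<open>fact (n - 1) / sqrt (n + 1)\<close> the section volume is the density \<open>f 0\<close> at \<open>0\<close> of
  \<open>X = (\<Sum>j. a j * E j)\<close> for independent standard exponential variables \<open>E j\<close>. This density is
  log-concave, since convolution with an exponential density preserves log-concavity, and \<open>X\<close> has
  mean \<open>0\<close> and variance \<open>1\<close>. Let \<open>p\<close>, \<open>m\<close>, \<open>A\<close> be the integrals of \<open>f x\<close>, \<open>x f x\<close>, \<open>x\<^sup>2 f x / 2\<close> over
  the positive half-line, and \<open>q\<close>, \<open>m\<close>, \<open>B\<close> those over the negative one; the two first moments agree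
  because the mean is \<open>0\<close>. Log-concavity of \<open>f\<close> and of its tail function gives
  \<open>f 0 * m \<le> p\<^sup>2\<close> and \<open>A * p \<le> m\<^sup>2\<close>, and likewise \<open>f 0 * m \<le> q\<^sup>2\<close> and \<open>B * q \<le> m\<^sup>2\<close>. With
  \<open>p + q = 1\<close> and \<open>A + B = 1 / 2\<close> this yields \<open>(f 0)\<^sup>2 \<le> 2 * p * q \<le> 1 / 2\<close>. If two coefficients are
  positive, then \<open>f 0 * m < p\<^sup>2\<close>; by the symmetry \<open>a \<mapsto> - a\<close>, equality leaves exactly one positive
  and one negative coefficient.
\<close>

subsection \<open>Log-concave functions on the line\<close>

text \<open>Given their sum, independent standard exponential variables are spread uniformly over a
  multiple of the simplex. The cone over the section meets the hyperplane of coordinate sum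
  \<open>\<rho>\<close> in a copy scaled by \<open>\<rho>\<close>, whose volume grows like
  \<open>\<rho> ^ (n - 1)\<close>; against \<open>exp (- \<rho>)\<close> this integrates to
  \<open>fact (n - 1)\<close>. Hyperplanes whose coordinate sums differ by \<open>1\<close> lie
  \<open>1 / sqrt (n + 1)\<close> apart, which is the other factor. The two moment inequalities are
  one statement, for \<open>f\<close> and for \<open>tail f\<close>: integrate
  \<open>f 0 * f (y + h) \<le> f y * f h\<close> over \<open>y, h \<ge> 0\<close>. Both are
  equalities when \<open>f\<close> is exponential on the half-line, so the model case is the
  two-sided exponential density, whose value at its mean is \<open>1 / sqrt 2\<close> for variance
  \<open>1\<close>. The obstacle is that a value at one point is at stake, while a density is
  determined only almost everywhere. Hence the density is an explicit integral with all pointwise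
  values fixed. A coefficient \<open>0\<close> gives a point mass, which has no density, so the
  recursion starts from a variable with nonzero coefficient.\<close>

definition expo :: "real \<Rightarrow> ennreal" where
  "expo s = ennreal (exp (- s)) * indicator {0..} s"

text \<open>If \<open>f\<close> is a density of \<open>X\<close> and \<open>E\<close> is an independent standard exponential variable, then
  \<open>smear c f\<close> is a density of \<open>X + c * E\<close>.\<close>

definition smear :: "real \<Rightarrow> (real \<Rightarrow> ennreal) \<Rightarrow> real \<Rightarrow> ennreal" where
  "smear c f x = (\<integral>\<^sup>+s. expo s * f (x - c * s) \<partial>lborel)"

definition tail :: "(real \<Rightarrow> ennreal) \<Rightarrow> real \<Rightarrow> ennreal" where
  "tail f x = (\<integral>\<^sup>+s. indicator {0..} s * f (x + s) \<partial>lborel)"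

text \<open>
  Log-concavity in the form of total positivity of order two: an inequality between products of
  values, so that it can be integrated factor by factor.
\<close>

definition log_concave :: "(real \<Rightarrow> ennreal) \<Rightarrow> bool" where
  "log_concave f \<longleftrightarrow> f \<in> borel_measurable borel \<and>
     (\<forall>x y h. x \<le> y \<longrightarrow> 0 \<le> h \<longrightarrow> f x * f (y + h) \<le> f (x + h) * f y)"

lemma log_concaveD: "log_concave f \<Longrightarrow> x \<le> y \<Longrightarrow> 0 \<le> h \<Longrightarrow> f x * f (y + h) \<le> f (x + h) * f y"
  by (auto simp: log_concave_def)

lemma log_concave_measurable: "log_concave f \<Longrightarrow> f \<in> borel_measurable borel"
  by (simp add: log_concave_def)

lemma measurable_expo [measurable]: "expo \<in> borel_measurable borel"
  unfolding expo_def by measurable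

lemma measurable_smear [measurable]:
  assumes [measurable]: "f \<in> borel_measurable borel"
  shows "smear c f \<in> borel_measurable borel"
  unfolding smear_def by measurable

lemma measurable_tail [measurable]:
  assumes [measurable]: "f \<in> borel_measurable borel"
  shows "tail f \<in> borel_measurable borel"
  unfolding tail_def by measurable

lemma nn_integral_translate:
  fixes f :: "real \<Rightarrow> ennreal"
  assumes "f \<in> borel_measurable borel"
  shows "(\<integral>\<^sup>+x. f (x + t) \<partial>lborel) = (\<integral>\<^sup>+x. f x \<partial>lborel)"
  using nn_integral_real_affine[of f 1 t] assms by (simp add: add.commute)

lemma nn_integral_reflect:
  fixes f :: "real \<Rightarrow> ennreal"
  assumes "f \<in> borel_measurable borel"
  shows "(\<integral>\<^sup>+x. f (- x) \<partial>lborel) = (\<integral>\<^sup>+x. f x \<partial>lborel)"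
  using nn_integral_real_affine[of f "-1" 0] assms by simp

lemma lborel_swap:
  fixes f :: "real \<Rightarrow> real \<Rightarrow> ennreal"
  assumes "case_prod f \<in> borel_measurable (borel \<Otimes>\<^sub>M borel)"
  shows "(\<integral>\<^sup>+y. (\<integral>\<^sup>+x. f x y \<partial>lborel) \<partial>lborel) = (\<integral>\<^sup>+x. (\<integral>\<^sup>+y. f x y \<partial>lborel) \<partial>lborel)"
  by (rule lborel_pair.Fubini') (use assms in simp)

lemma nn_integral_times_nn_integral:
  fixes f g :: "real \<Rightarrow> ennreal"
  assumes [measurable]: "f \<in> borel_measurable borel" "g \<in> borel_measurable borel"
  shows "(\<integral>\<^sup>+x. f x \<partial>lborel) * (\<integral>\<^sup>+y. g y \<partial>lborel) = (\<integral>\<^sup>+x. (\<integral>\<^sup>+y. f x * g y \<partial>lborel) \<partial>lborel)"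
  by (simp add: nn_integral_cmult nn_integral_multc)

text \<open>Memorylessness: the part of the integral with \<open>s \<ge> h / c\<close> is, after a
  shift by \<open>h / c\<close>, again \<open>smear c f x\<close> with weight
  \<open>exp (- (h / c))\<close>. The remainder sees \<open>f\<close> only between \<open>x\<close>
  and \<open>x + h\<close>.\<close>

lemma smear_add:
  assumes [measurable]: "f \<in> borel_measurable borel" and c: "c > 0" and h: "h \<ge> 0"
  shows "smear c f (x + h) = ennreal (exp (- (h / c))) * smear c f x +
           (\<integral>\<^sup>+s. expo s * indicator {..<h / c} s * f (x + h - c * s) \<partial>lborel)"
proof -
  have "smear c f (x + h) = (\<integral>\<^sup>+s. expo s * indicator {h / c..} s * f (x + h - c * s)
      + expo s * indicator {..<h / c} s * f (x + h - c * s) \<partial>lborel)"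
    unfolding smear_def by (intro nn_integral_cong) (auto split: split_indicator)
  also have "\<dots> = (\<integral>\<^sup>+s. expo s * indicator {h / c..} s * f (x + h - c * s) \<partial>lborel)
      + (\<integral>\<^sup>+s. expo s * indicator {..<h / c} s * f (x + h - c * s) \<partial>lborel)"
    by (rule nn_integral_add) measurable
  also have "(\<integral>\<^sup>+s. expo s * indicator {h / c..} s * f (x + h - c * s) \<partial>lborel)
      = (\<integral>\<^sup>+s. expo (s + h / c) * indicator {h / c..} (s + h / c) * f (x + h - c * (s + h / c)) \<partial>lborel)"
    by (rule nn_integral_translate[symmetric]) measurable
  also have "\<dots> = (\<integral>\<^sup>+s. ennreal (exp (- (h / c))) * (expo s * f (x - c * s)) \<partial>lborel)"
  proof (rule nn_integral_cong)
    fix s :: real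
    have *: "x + h - c * (s + h / c) = x - c * s" using c by (simp add: field_simps)
    have "exp (- (s + h / c)) = exp (- (h / c)) * exp (- s)" by (simp flip: exp_add)
    then have **: "ennreal (exp (- (s + h / c))) = ennreal (exp (- (h / c))) * ennreal (exp (- s))"
      by (simp add: ennreal_mult)
    have "h / c \<ge> 0" using c h by simp
    then show "expo (s + h / c) * indicator {h / c..} (s + h / c) * f (x + h - c * (s + h / c))
      = ennreal (exp (- (h / c))) * (expo s * f (x - c * s))"
      unfolding * expo_def ** by (auto split: split_indicator simp: mult_ac)
  qed
  also have "\<dots> = ennreal (exp (- (h / c))) * smear c f x"
    unfolding smear_def by (rule nn_integral_cmult) measurable
  finally show ?thesis .
qed

text \<open>\<open>smear_add\<close> produces the same term
  \<open>exp (- (h / c)) * smear c f x * smear c f y\<close> on both sides. The remaining double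
  integrals compare pointwise: the inequality for \<open>f\<close> is used at
  \<open>x - c * r\<close> and \<open>y - c * r\<close> with shift \<open>h + c * r - c * s\<close>,
  nonnegative because \<open>r \<ge> 0\<close> and \<open>s < h / c\<close>.\<close>

lemma log_concave_smear_pos:
  assumes f: "log_concave f" and c: "c > 0"
  shows "log_concave (smear c f)"
  unfolding log_concave_def
proof (intro conjI allI impI)
  note [measurable] = log_concave_measurable[OF f]
  show "smear c f \<in> borel_measurable borel" by measurable
  fix x y h :: real assume xy: "x \<le> y" and h: "0 \<le> h"
  let ?k = "\<lambda>x s. expo s * indicator {..<h / c} s * f (x + h - c * s)"
  let ?K = "\<lambda>x. \<integral>\<^sup>+s. ?k x s \<partial>lborel"
  have "smear c f x * ?K y = (\<integral>\<^sup>+r. \<integral>\<^sup>+s. (expo r * f (x - c * r)) * ?k y s \<partial>lborel \<partial>lborel)"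
    unfolding smear_def by (rule nn_integral_times_nn_integral) measurable
  also have "\<dots> \<le> (\<integral>\<^sup>+r. \<integral>\<^sup>+s. (expo r * f (y - c * r)) * ?k x s \<partial>lborel \<partial>lborel)"
  proof (intro nn_integral_mono)
    fix r s :: real
    show "(expo r * f (x - c * r)) * ?k y s \<le> (expo r * f (y - c * r)) * ?k x s"
    proof (cases "r \<ge> 0 \<and> s < h / c")
      case True
      then have "c * s \<le> h" "c * r \<ge> 0" using c by (auto simp: field_simps)
      then have "f (x - c * r) * f (y - c * r + (h + c * r - c * s)) \<le> f (x - c * r + (h + c * r - c * s)) * f (y - c * r)"
        by (intro log_concaveD[OF f]) (use xy in auto)
      then have "f (x - c * r) * f (y + h - c * s) \<le> f (x + h - c * s) * f (y - c * r)"
        by (simp add: algebra_simps)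
      then have "(expo r * (expo s * indicator {..<h / c} s)) * (f (x - c * r) * f (y + h - c * s))
         \<le> (expo r * (expo s * indicator {..<h / c} s)) * (f (x + h - c * s) * f (y - c * r))"
        by (rule mult_left_mono) simp
      then show ?thesis by (simp add: mult_ac)
    next
      case False
      then show ?thesis by (auto simp: expo_def split: split_indicator)
    qed
  qed
  also have "\<dots> = smear c f y * ?K x"
    unfolding smear_def by (rule nn_integral_times_nn_integral[symmetric]) measurable
  finally have "smear c f x * ?K y \<le> smear c f y * ?K x" .
  then show "smear c f x * smear c f (y + h) \<le> smear c f (x + h) * smear c f y"
    unfolding smear_add[OF log_concave_measurable[OF f] c h]
    by (simp add: distrib_left distrib_right mult_ac add_left_mono)
qed

lemma log_concave_reflect:
  assumes f: "log_concave f"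
  shows "log_concave (\<lambda>x. f (- x))"
  unfolding log_concave_def
proof (intro conjI allI impI)
  note [measurable] = log_concave_measurable[OF f]
  show "(\<lambda>x. f (- x)) \<in> borel_measurable borel" by measurable
  fix x y h :: real assume "x \<le> y" "0 \<le> h"
  then show "f (- x) * f (- (y + h)) \<le> f (- (x + h)) * f (- y)"
    using log_concaveD[OF f, of "- (y + h)" "- (x + h)" h] by (simp add: mult_ac)
qed

lemma nn_integral_power_expo: "(\<integral>\<^sup>+s. ennreal (s ^ k) * expo s \<partial>lborel) = ennreal (fact k)"
proof -
  have "(\<integral>\<^sup>+s. ennreal (s ^ k) * expo s \<partial>lborel) = (\<integral>\<^sup>+x. ennreal (x^k * exp (-x)) * indicator {0 ..} x \<partial>lborel)"
    by (intro nn_integral_cong) (auto simp: expo_def ennreal_mult' split: split_indicator)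
  also have "\<dots> = ennreal (real (fact k))" by (rule nn_intergal_power_times_exp_Ici)
  finally show ?thesis by simp
qed

lemma nn_integral_expo: "(\<integral>\<^sup>+s. expo s \<partial>lborel) = 1"
  using nn_integral_power_expo[of 0] by simp

lemma smear_0: "smear 0 f = f"
  by (rule ext) (simp add: smear_def nn_integral_multc nn_integral_expo)

lemma smear_reflect: "smear c f (- x) = smear (- c) (\<lambda>x. f (- x)) x"
  by (simp add: smear_def)

lemma log_concave_smear:
  assumes f: "log_concave f"
  shows "log_concave (smear c f)"
proof -
  consider "c > 0" | "c = 0" | "c < 0" by linarith
  then show ?thesis
  proof cases
    case 3
    have "log_concave (\<lambda>x. smear (- c) (\<lambda>x. f (- x)) (- x))"
      by (intro log_concave_reflect log_concave_smear_pos f) (use 3 in simp)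
    then show ?thesis by (simp add: smear_reflect)
  qed (use f in \<open>auto simp: smear_0 log_concave_smear_pos\<close>)
qed

lemma tail_add:
  assumes [measurable]: "f \<in> borel_measurable borel" and h: "h \<ge> 0"
  shows "tail f x = (\<integral>\<^sup>+s. indicator {0..<h} s * f (x + s) \<partial>lborel) + tail f (x + h)"
proof -
  have "tail f x = (\<integral>\<^sup>+s. indicator {0..<h} s * f (x + s) + indicator {h..} s * f (x + s) \<partial>lborel)"
    unfolding tail_def by (intro nn_integral_cong) (use h in \<open>auto split: split_indicator\<close>)
  also have "\<dots> = (\<integral>\<^sup>+s. indicator {0..<h} s * f (x + s) \<partial>lborel) + (\<integral>\<^sup>+s. indicator {h..} s * f (x + s) \<partial>lborel)"
    by (rule nn_integral_add) measurable
  also have "(\<integral>\<^sup>+s. indicator {h..} s * f (x + s) \<partial>lborel) = (\<integral>\<^sup>+s. indicator {h..} (s + h) * f (x + (s + h)) \<partial>lborel)"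
    by (rule nn_integral_translate[symmetric]) measurable
  also have "\<dots> = tail f (x + h)"
    unfolding tail_def by (intro nn_integral_cong) (auto split: split_indicator simp: add_ac)
  finally show ?thesis .
qed

text \<open>Both sides share the term \<open>tail f (x + h) * tail f (y + h)\<close>. The remaining
  products compare pointwise through the shift \<open>h + r - s\<close>, nonnegative because
  \<open>s < h\<close> and \<open>r \<ge> 0\<close>.\<close>

lemma log_concave_tail:
  assumes f: "log_concave f"
  shows "log_concave (tail f)"
  unfolding log_concave_def
proof (intro conjI allI impI)
  note [measurable] = log_concave_measurable[OF f]
  show "tail f \<in> borel_measurable borel" by measurable
  fix x y h :: real assume xy: "x \<le> y" and h: "0 \<le> h"
  let ?k = "\<lambda>x s. indicator {0..<h} s * f (x + s)"
  let ?K = "\<lambda>x. \<integral>\<^sup>+s. ?k x s \<partial>lborel"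
  have "?K x * tail f (y + h) = (\<integral>\<^sup>+s. \<integral>\<^sup>+r. ?k x s * (indicator {0..} r * f (y + h + r)) \<partial>lborel \<partial>lborel)"
    unfolding tail_def by (rule nn_integral_times_nn_integral) measurable
  also have "\<dots> \<le> (\<integral>\<^sup>+s. \<integral>\<^sup>+r. ?k y s * (indicator {0..} r * f (x + h + r)) \<partial>lborel \<partial>lborel)"
  proof (intro nn_integral_mono)
    fix r s :: real
    show "?k x s * (indicator {0..} r * f (y + h + r)) \<le> ?k y s * (indicator {0..} r * f (x + h + r))"
    proof (cases "r \<ge> 0 \<and> s < h")
      case True
      then show ?thesis
        using log_concaveD[OF f, of "x + s" "y + s" "h + r - s"] xy
        by (auto split: split_indicator simp: algebra_simps)
    qed (auto split: split_indicator)
  qed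
  also have "\<dots> = ?K y * tail f (x + h)"
    unfolding tail_def by (rule nn_integral_times_nn_integral[symmetric]) measurable
  finally have *: "?K x * tail f (y + h) \<le> ?K y * tail f (x + h)" .
  show "tail f x * tail f (y + h) \<le> tail f (x + h) * tail f y"
    unfolding tail_add[OF log_concave_measurable[OF f] h, of x] tail_add[OF log_concave_measurable[OF f] h, of y]
    using * by (simp add: distrib_left distrib_right mult_ac add_right_mono)
qed

text \<open>Since \<open>x \<le> 0 \<le> h\<close>, log-concavity gives
  \<open>f x * f (h + y) \<le> f (x + y) * f h\<close>; integrate this over the quadrant
  \<open>y, h \<ge> 0\<close>. The moment bounds are the case \<open>x = 0\<close>, for
  \<open>f\<close> and for \<open>tail f\<close>; the strict inequality averages over
  \<open>x = - c * s\<close>.\<close>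

lemma log_concave_tail_ineq:
  assumes f: "log_concave f"
    and x: "x \<le> 0"
  shows "f x * tail (tail f) 0 \<le> tail f x * tail f 0"
proof -
  note [measurable] = log_concave_measurable[OF f]
  have "f x * tail (tail f) 0 = (\<integral>\<^sup>+y. \<integral>\<^sup>+h. f x * (indicator {0..} y * (indicator {0..} h * f (0 + y + h))) \<partial>lborel \<partial>lborel)"
    by (simp add: tail_def nn_integral_cmult)
  also have "\<dots> \<le> (\<integral>\<^sup>+y. \<integral>\<^sup>+h. (indicator {0..} y * f (x + y)) * (indicator {0..} h * f (0 + h)) \<partial>lborel \<partial>lborel)"
  proof (intro nn_integral_mono)
    fix y h :: real
    show "f x * (indicator {0..} y * (indicator {0..} h * f (0 + y + h)))
      \<le> (indicator {0..} y * f (x + y)) * (indicator {0..} h * f (0 + h))"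
      using log_concaveD[OF f, of x h y] x by (auto split: split_indicator simp: add.commute)
  qed
  also have "\<dots> = tail f x * tail f 0"
    unfolding tail_def
    by (rule nn_integral_times_nn_integral[symmetric]) measurable
  finally show ?thesis .
qed

section \<open>Half-line moments as iterated tails\<close>

lemma nn_integral_weight_tail:
  assumes [measurable]: "f \<in> borel_measurable borel" "w \<in> borel_measurable borel"
  shows "(\<integral>\<^sup>+y. w y * indicator {0..} y * tail f y \<partial>lborel)
    = (\<integral>\<^sup>+s. (\<integral>\<^sup>+y. w y * indicator {0..s} y \<partial>lborel) * (indicator {0..} s * f s) \<partial>lborel)"
proof -
  have "(\<integral>\<^sup>+y. w y * indicator {0..} y * tail f y \<partial>lborel)
     = (\<integral>\<^sup>+y. (\<integral>\<^sup>+s. w y * indicator {0..} y * (indicator {y..} s * f s) \<partial>lborel) \<partial>lborel)"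
  proof (rule nn_integral_cong)
    fix y :: real
    have "tail f y = (\<integral>\<^sup>+s. indicator {y..} (s + y) * f (s + y) \<partial>lborel)"
      unfolding tail_def by (intro nn_integral_cong) (auto split: split_indicator simp: add_ac)
    also have "\<dots> = (\<integral>\<^sup>+s. indicator {y..} s * f s \<partial>lborel)"
      by (rule nn_integral_translate) measurable
    finally show "w y * indicator {0..} y * tail f y = (\<integral>\<^sup>+s. w y * indicator {0..} y * (indicator {y..} s * f s) \<partial>lborel)"
      by (simp add: nn_integral_cmult)
  qed
  \<comment> \<open>Exchanging the integrals over \<open>0 \<le> y \<le> s\<close> turns the weight
    \<open>w\<close> into its primitive at \<open>s\<close>; the weights \<open>1\<close> and
    \<open>y\<close> will give \<open>s\<close> and \<open>s\<^sup>2 / 2\<close>.\<close>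
  also have "\<dots> = (\<integral>\<^sup>+s. (\<integral>\<^sup>+y. w y * indicator {0..} y * (indicator {y..} s * f s) \<partial>lborel) \<partial>lborel)"
  proof (rule lborel_swap)
    \<comment> \<open>The set \<open>{y..}\<close> moves with \<open>y\<close>; joint measurability
      becomes visible once membership is written as the condition \<open>y \<le> x\<close>.\<close>
    have "(\<lambda>(x, y). w y * indicator {0..} y * ((if y \<le> x then 1 else 0) * f x)) \<in> borel_measurable (borel \<Otimes>\<^sub>M borel)"
      by measurable
    then show "(\<lambda>(x, y). w y * indicator {0..} y * (indicator {y..} x * f x)) \<in> borel_measurable (borel \<Otimes>\<^sub>M borel)"
      by (simp add: indicator_def)
  qed
  also have "\<dots> = (\<integral>\<^sup>+s. (\<integral>\<^sup>+y. (w y * indicator {0..s} y) * (indicator {0..} s * f s) \<partial>lborel) \<partial>lborel)"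
    by (intro nn_integral_cong) (auto split: split_indicator)
  finally show ?thesis by (simp add: nn_integral_multc)
qed

lemma nn_integral_power_Icc:
  fixes s :: real assumes "s \<ge> 0"
  shows "(\<integral>\<^sup>+y. ennreal (y ^ k) * indicator {0..s} y \<partial>lborel) = ennreal (s ^ Suc k / Suc k)"
proof -
  have "(\<integral>\<^sup>+y. ennreal (y ^ k) * indicator {0..s} y \<partial>lborel) = ennreal (s ^ Suc k / Suc k - 0 ^ Suc k / Suc k)"
    using assms by (intro nn_integral_FTC_Icc) (auto intro!: derivative_eq_intros simp del: power_Suc)
  then show ?thesis by simp
qed

lemma tail_0: "tail f 0 = (\<integral>\<^sup>+s. indicator {0..} s * f s \<partial>lborel)"
  by (simp add: tail_def)

lemma tail_tail_0:
  assumes [measurable]: "f \<in> borel_measurable borel"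
  shows "tail (tail f) 0 = (\<integral>\<^sup>+s. ennreal s * (indicator {0..} s * f s) \<partial>lborel)"
proof -
  have "tail (tail f) 0 = (\<integral>\<^sup>+y. ennreal (y ^ 0) * indicator {0..} y * tail f y \<partial>lborel)"
    by (simp add: tail_0)
  also have "\<dots> = (\<integral>\<^sup>+s. (\<integral>\<^sup>+y. ennreal (y ^ 0) * indicator {0..s} y \<partial>lborel) * (indicator {0..} s * f s) \<partial>lborel)"
    by (rule nn_integral_weight_tail) measurable
  also have "\<dots> = (\<integral>\<^sup>+s. ennreal s * (indicator {0..} s * f s) \<partial>lborel)"
    by (intro nn_integral_cong) (auto split: split_indicator)
  finally show ?thesis .
qed

lemma tail_tail_tail_0:
  assumes [measurable]: "f \<in> borel_measurable borel"
  shows "tail (tail (tail f)) 0 = (\<integral>\<^sup>+s. ennreal (s\<^sup>2 / 2) * (indicator {0..} s * f s) \<partial>lborel)"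
proof -
  have "tail (tail (tail f)) 0 = (\<integral>\<^sup>+y. ennreal (y ^ 1) * indicator {0..} y * tail f y \<partial>lborel)"
    by (simp add: tail_tail_0 mult_ac)
  also have "\<dots> = (\<integral>\<^sup>+s. (\<integral>\<^sup>+y. ennreal (y ^ 1) * indicator {0..s} y \<partial>lborel) * (indicator {0..} s * f s) \<partial>lborel)"
    by (rule nn_integral_weight_tail) measurable
  also have "\<dots> = (\<integral>\<^sup>+s. ennreal (s\<^sup>2 / 2) * (indicator {0..} s * f s) \<partial>lborel)"
    by (intro nn_integral_cong) (auto split: split_indicator simp: nn_integral_power_Icc[of _ 1, simplified] power2_eq_square)
  finally show ?thesis .
qed

section \<open>Mean and variance under convolution\<close>

lemma nn_integral_smear:
  assumes [measurable]: "f \<in> borel_measurable borel" "\<phi> \<in> borel_measurable borel"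
  shows "(\<integral>\<^sup>+x. \<phi> x * smear c f x \<partial>lborel) = (\<integral>\<^sup>+s. expo s * (\<integral>\<^sup>+x. \<phi> (x + c * s) * f x \<partial>lborel) \<partial>lborel)"
proof -
  have "(\<integral>\<^sup>+x. \<phi> x * smear c f x \<partial>lborel) = (\<integral>\<^sup>+x. (\<integral>\<^sup>+s. expo s * (\<phi> x * f (x - c * s)) \<partial>lborel) \<partial>lborel)"
    unfolding smear_def by (simp add: nn_integral_cmult[symmetric] mult_ac)
  also have "\<dots> = (\<integral>\<^sup>+s. (\<integral>\<^sup>+x. expo s * (\<phi> x * f (x - c * s)) \<partial>lborel) \<partial>lborel)"
    by (rule lborel_swap) measurable
  also have "\<dots> = (\<integral>\<^sup>+s. expo s * (\<integral>\<^sup>+x. \<phi> (x + c * s) * f x \<partial>lborel) \<partial>lborel)"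
  proof (rule nn_integral_cong)
    fix s
    have "(\<integral>\<^sup>+x. \<phi> x * f (x - c * s) \<partial>lborel) = (\<integral>\<^sup>+x. \<phi> (x + c * s) * f ((x + c * s) - c * s) \<partial>lborel)"
      by (rule nn_integral_translate[symmetric]) measurable
    then show "(\<integral>\<^sup>+x. expo s * (\<phi> x * f (x - c * s)) \<partial>lborel) = expo s * (\<integral>\<^sup>+x. \<phi> (x + c * s) * f x \<partial>lborel)"
      by (simp add: nn_integral_cmult)
  qed
  finally show ?thesis .
qed

lemma integral_power_expo:
  "has_bochner_integral lborel (\<lambda>s::real. s ^ k * (exp (- s) * indicator {0..} s)) (fact k)"
proof (rule has_bochner_integral_nn_integral)
  show "(\<integral>\<^sup>+x. ennreal (x ^ k * (exp (- x) * indicator {0..} x)) \<partial>lborel) = ennreal (fact k)"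
    unfolding nn_integral_power_expo[symmetric]
    by (intro nn_integral_cong) (auto simp: expo_def ennreal_mult' split: split_indicator)
qed (auto split: split_indicator)

lemma expo_eq: "expo s = ennreal (exp (- s) * indicator {0..} s)"
  by (auto simp: expo_def split: split_indicator)

text \<open>A standard exponential variable has mean and variance \<open>1\<close>. The linear term
  \<open>2 * p * c * s\<close> may be negative, so the moments are added as real integrals and only
  the nonnegative total is taken back to \<open>ennreal\<close>.\<close>

lemma nn_integral_quadratic_expo:
  assumes "v \<ge> 0"
  shows "(\<integral>\<^sup>+s. expo s * ennreal ((p + c * s)\<^sup>2 + v) \<partial>lborel) = ennreal ((p + c)\<^sup>2 + (v + c\<^sup>2))"
proof -
  let ?e = "\<lambda>s::real. exp (- s) * indicator {0..} s"
  have "has_bochner_integral lborel (\<lambda>s. (p\<^sup>2 + v) * (s ^ 0 * ?e s) + 2 * p * c * (s ^ 1 * ?e s) + c\<^sup>2 * (s ^ 2 * ?e s))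
     ((p\<^sup>2 + v) * fact 0 + 2 * p * c * fact 1 + c\<^sup>2 * fact 2)"
    by (intro has_bochner_integral_add has_bochner_integral_mult_right integral_power_expo)
  also have "(\<lambda>s. (p\<^sup>2 + v) * (s ^ 0 * ?e s) + 2 * p * c * (s ^ 1 * ?e s) + c\<^sup>2 * (s ^ 2 * ?e s)) = (\<lambda>s. ?e s * ((p + c * s)\<^sup>2 + v))"
    by (auto simp: fun_eq_iff algebra_simps power2_eq_square)
  also have "(p\<^sup>2 + v) * fact 0 + 2 * p * c * fact 1 + c\<^sup>2 * fact 2 = (p + c)\<^sup>2 + (v + c\<^sup>2)"
    by (simp add: algebra_simps power2_eq_square)
  finally have h: "has_bochner_integral lborel (\<lambda>s. ?e s * ((p + c * s)\<^sup>2 + v)) ((p + c)\<^sup>2 + (v + c\<^sup>2))" .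
  have "(\<integral>\<^sup>+s. expo s * ennreal ((p + c * s)\<^sup>2 + v) \<partial>lborel) = (\<integral>\<^sup>+s. ennreal (?e s * ((p + c * s)\<^sup>2 + v)) \<partial>lborel)"
    using assms by (intro nn_integral_cong) (simp add: expo_eq ennreal_mult)
  also have "\<dots> = ennreal (integral\<^sup>L lborel (\<lambda>s. ?e s * ((p + c * s)\<^sup>2 + v)))"
    using h assms by (intro nn_integral_eq_integral) (auto simp: has_bochner_integral_iff)
  also have "integral\<^sup>L lborel (\<lambda>s. ?e s * ((p + c * s)\<^sup>2 + v)) = (p + c)\<^sup>2 + (v + c\<^sup>2)"
    using h by (simp add: has_bochner_integral_iff)
  finally show ?thesis .
qed

text \<open>A nonnegative integral cannot hold the signed first moment, so the mean is encoded by
  the second moments about all centres \<open>- u\<close>. This family determines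
  \<open>\<mu>\<close> and \<open>v\<close>, and it passes through a convolution because
  \<open>u\<close> may be replaced by \<open>c * s + u\<close>.\<close>

definition has_mean_var :: "(real \<Rightarrow> ennreal) \<Rightarrow> real \<Rightarrow> real \<Rightarrow> bool" where
  "has_mean_var f \<mu> v \<longleftrightarrow> v \<ge> 0 \<and> (\<integral>\<^sup>+x. f x \<partial>lborel) = 1 \<and>
     (\<forall>u. (\<integral>\<^sup>+x. ennreal ((x + u)\<^sup>2) * f x \<partial>lborel) = ennreal ((\<mu> + u)\<^sup>2 + v))"

lemma has_mean_var_smear:
  assumes f: "has_mean_var f \<mu> v" and [measurable]: "f \<in> borel_measurable borel"
  shows "has_mean_var (smear c f) (\<mu> + c) (v + c\<^sup>2)"
  unfolding has_mean_var_def
proof (intro conjI allI)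
  have v: "v \<ge> 0" using f by (simp add: has_mean_var_def)
  then show "0 \<le> v + c\<^sup>2" by simp
  show "(\<integral>\<^sup>+x. smear c f x \<partial>lborel) = 1"
    using nn_integral_smear[of f "\<lambda>_. 1" c] f by (simp add: has_mean_var_def nn_integral_expo)
  fix u
  have "(\<integral>\<^sup>+x. ennreal ((x + u)\<^sup>2) * smear c f x \<partial>lborel)
      = (\<integral>\<^sup>+s. expo s * (\<integral>\<^sup>+x. ennreal ((x + (c * s + u))\<^sup>2) * f x \<partial>lborel) \<partial>lborel)"
    by (subst nn_integral_smear) (simp_all add: add.assoc)
  also have "\<dots> = (\<integral>\<^sup>+s. expo s * ennreal ((\<mu> + u + c * s)\<^sup>2 + v) \<partial>lborel)"
  proof -
    have "(\<integral>\<^sup>+x. ennreal ((x + (c * s + u))\<^sup>2) * f x \<partial>lborel) = ennreal ((\<mu> + u + c * s)\<^sup>2 + v)" for s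
      using f[unfolded has_mean_var_def, THEN conjunct2, THEN conjunct2, THEN spec, of "c * s + u"]
      by (simp only: add_ac)
    then show ?thesis by simp
  qed
  also have "\<dots> = ennreal ((\<mu> + c + u)\<^sup>2 + (v + c\<^sup>2))"
    using nn_integral_quadratic_expo[OF v, of "\<mu> + u" c] by (simp add: algebra_simps)
  finally show "(\<integral>\<^sup>+x. ennreal ((x + u)\<^sup>2) * smear c f x \<partial>lborel) = ennreal ((\<mu> + c + u)\<^sup>2 + (v + c\<^sup>2))" .
qed

text \<open>For \<open>c \<noteq> 0\<close> the density of \<open>c * E\<close> with
  \<open>E\<close> standard exponential; for negative \<open>c\<close> the support is the left
  half-line. At \<open>c = 0\<close> division by zero makes it the zero function.\<close>

definition expo_density :: "real \<Rightarrow> real \<Rightarrow> ennreal" where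
  "expo_density c x = ennreal (1 / \<bar>c\<bar>) * expo (x / c)"

lemma measurable_expo_density [measurable]: "expo_density c \<in> borel_measurable borel"
  unfolding expo_density_def by measurable

lemma nn_integral_expo_density:
  assumes [measurable]: "\<phi> \<in> borel_measurable borel" and c: "c \<noteq> 0"
  shows "(\<integral>\<^sup>+x. \<phi> x * expo_density c x \<partial>lborel) = (\<integral>\<^sup>+s. expo s * \<phi> (c * s) \<partial>lborel)"
proof -
  have "(\<integral>\<^sup>+x. \<phi> x * expo_density c x \<partial>lborel)
      = ennreal \<bar>c\<bar> * (\<integral>\<^sup>+s. \<phi> (0 + c * s) * expo_density c (0 + c * s) \<partial>lborel)"
    by (rule nn_integral_real_affine[OF _ c]) measurable
  also have "\<dots> = (\<integral>\<^sup>+s. ennreal \<bar>c\<bar> * (\<phi> (0 + c * s) * expo_density c (0 + c * s)) \<partial>lborel)"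
    by (rule nn_integral_cmult[symmetric]) measurable
  also have "\<dots> = (\<integral>\<^sup>+s. expo s * \<phi> (c * s) \<partial>lborel)"
  proof (rule nn_integral_cong)
    fix s
    have "ennreal \<bar>c\<bar> * ennreal (1 / \<bar>c\<bar>) = 1" using c by (simp flip: ennreal_mult')
    then have *: "ennreal \<bar>c\<bar> * (ennreal (1 / \<bar>c\<bar>) * z) = z" for z by (simp flip: mult.assoc)
    show "ennreal \<bar>c\<bar> * (\<phi> (0 + c * s) * expo_density c (0 + c * s)) = expo s * \<phi> (c * s)"
      using c *[of "expo s * \<phi> (c * s)"] by (simp add: expo_density_def mult_ac)
  qed
  finally show ?thesis .
qed

lemma has_mean_var_expo_density:
  assumes c: "c \<noteq> 0"
  shows "has_mean_var (expo_density c) c (c\<^sup>2)"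
  unfolding has_mean_var_def
  using nn_integral_expo_density[of "\<lambda>_. 1", OF _ c] nn_integral_expo_density[OF _ c, of "\<lambda>x. ennreal ((x + _)\<^sup>2)"]
    nn_integral_quadratic_expo[of 0 _ c]
  by (simp add: nn_integral_expo add.commute)

text \<open>For positive coefficients the two products are equal when \<open>x \<ge> 0\<close>,
  because exponents add; for \<open>x < 0\<close> the left factor at \<open>x\<close> vanishes.
  Negative coefficients follow by reflection.\<close>

lemma log_concave_expo_density:
  assumes c: "c \<noteq> 0"
  shows "log_concave (expo_density c)"
proof -
  have "log_concave (expo_density c)" if c: "c > 0" for c
    unfolding log_concave_def
  proof (intro conjI allI impI)
    fix x y h :: real assume "x \<le> y" "0 \<le> h"
    show "expo_density c x * expo_density c (y + h) \<le> expo_density c (x + h) * expo_density c y"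
    proof (cases "x \<ge> 0")
      case True
      have "expo (x / c) * expo ((y + h) / c) = expo ((x + h) / c) * expo (y / c)"
        using True \<open>x \<le> y\<close> \<open>0 \<le> h\<close> c
        by (simp add: expo_eq flip: ennreal_mult exp_add) (simp add: add_divide_distrib add_ac)
      then have "ennreal (1 / \<bar>c\<bar>) * ennreal (1 / \<bar>c\<bar>) * (expo (x / c) * expo ((y + h) / c))
          = ennreal (1 / \<bar>c\<bar>) * ennreal (1 / \<bar>c\<bar>) * (expo ((x + h) / c) * expo (y / c))" by simp
      then show ?thesis by (simp add: expo_density_def mult_ac)
    next
      case False
      then show ?thesis using c by (simp add: expo_density_def expo_def field_simps)
    qed
  qed measurable
  moreover have "expo_density c = (\<lambda>x. expo_density (- c) (- x))"
    by (simp add: expo_density_def fun_eq_iff)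
  ultimately show ?thesis
    using c log_concave_reflect[of "expo_density (- c)"] by (metis neg_0_less_iff_less linorder_neqE_linordered_idom)
qed

section \<open>Tails of a convolution and the strict inequality\<close>

lemma tail_smear:
  assumes [measurable]: "f \<in> borel_measurable borel"
  shows "tail (smear c f) x = smear c (tail f) x"
proof -
  have "tail (smear c f) x = (\<integral>\<^sup>+r. (\<integral>\<^sup>+s. expo s * (indicator {0..} r * f (x + r - c * s)) \<partial>lborel) \<partial>lborel)"
    unfolding smear_def tail_def by (simp add: nn_integral_cmult[symmetric] mult_ac)
  also have "\<dots> = (\<integral>\<^sup>+s. (\<integral>\<^sup>+r. expo s * (indicator {0..} r * f (x + r - c * s)) \<partial>lborel) \<partial>lborel)"
    by (rule lborel_swap) measurable
  also have "\<dots> = smear c (tail f) x"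
    unfolding smear_def tail_def by (simp add: nn_integral_cmult algebra_simps)
  finally show ?thesis .
qed

text \<open>The integrated form of the differential equation \<open>c * g' = f - g\<close> for
  \<open>g = smear c f\<close>. It is obtained without derivatives by integrating
  \<open>smear_add\<close> over \<open>h \<ge> 0\<close>: the first summand contributes
  \<open>c * g x\<close>, and in the second a shift by \<open>c * s\<close> gives
  \<open>tail f x\<close> for every \<open>s \<ge> 0\<close>.\<close>

lemma tail_smear_pos:
  assumes [measurable]: "f \<in> borel_measurable borel" and c: "c > 0"
  shows "tail (smear c f) x = ennreal c * smear c f x + tail f x"
proof -
  have "tail (smear c f) x = (\<integral>\<^sup>+h. indicator {0..} h * ennreal (exp (- (h / c))) * smear c f x
     + (\<integral>\<^sup>+s. expo s * (indicator {0..} h * indicator {..<h / c} s * f (x + h - c * s)) \<partial>lborel) \<partial>lborel)"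
    unfolding tail_def
  proof (rule nn_integral_cong)
    fix h
    have [measurable]: "(\<lambda>s. expo s * (indicator {0..} h * indicator {..<h / c} s * f (x + h - c * s))) \<in> borel_measurable borel"
      by measurable
    show "indicator {0..} h * smear c f (x + h) = indicator {0..} h * ennreal (exp (- (h / c))) * smear c f x
     + (\<integral>\<^sup>+s. expo s * (indicator {0..} h * indicator {..<h / c} s * f (x + h - c * s)) \<partial>lborel)"
      by (cases "h \<ge> 0") (simp_all add: smear_add[OF _ c] mult.assoc)
  qed
  also have "\<dots> = (\<integral>\<^sup>+h. indicator {0..} h * ennreal (exp (- (h / c))) * smear c f x \<partial>lborel)
     + (\<integral>\<^sup>+h. (\<integral>\<^sup>+s. expo s * (indicator {0..} h * indicator {..<h / c} s * f (x + h - c * s)) \<partial>lborel) \<partial>lborel)"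
  proof (rule nn_integral_add)
    have "(\<lambda>(h, s). expo s * (indicator {0..} h * (if s < h / c then 1 else 0) * f (x + h - c * s))) \<in> borel_measurable (borel \<Otimes>\<^sub>M borel)"
      by measurable
    then show "(\<lambda>h. \<integral>\<^sup>+s. expo s * (indicator {0..} h * indicator {..<h / c} s * f (x + h - c * s)) \<partial>lborel) \<in> borel_measurable lborel"
      by (intro lborel.borel_measurable_nn_integral) (simp add: indicator_def)
  qed measurable
  also have "(\<integral>\<^sup>+h. indicator {0..} h * ennreal (exp (- (h / c))) * smear c f x \<partial>lborel) = ennreal c * smear c f x"
  proof -
    have "(\<integral>\<^sup>+h. indicator {0..} h * ennreal (exp (- (h / c))) \<partial>lborel) = (\<integral>\<^sup>+h. ennreal c * expo_density c h \<partial>lborel)"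
      using c by (intro nn_integral_cong)
        (auto simp: expo_density_def expo_def ennreal_mult'[symmetric] zero_le_divide_iff split: split_indicator)
    also have "\<dots> = ennreal c"
      using has_mean_var_expo_density[of c] c by (simp add: nn_integral_cmult has_mean_var_def)
    finally show ?thesis by (simp add: nn_integral_multc)
  qed
  also have "(\<integral>\<^sup>+h. (\<integral>\<^sup>+s. expo s * (indicator {0..} h * indicator {..<h / c} s * f (x + h - c * s)) \<partial>lborel) \<partial>lborel)
      = (\<integral>\<^sup>+s. (\<integral>\<^sup>+h. expo s * (indicator {0..} h * indicator {..<h / c} s * f (x + h - c * s)) \<partial>lborel) \<partial>lborel)"
  proof (rule lborel_swap)
    have "(\<lambda>(s, h). expo s * (indicator {0..} h * (if s < h / c then 1 else 0) * f (x + h - c * s))) \<in> borel_measurable (borel \<Otimes>\<^sub>M borel)"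
      by measurable
    then show "(\<lambda>(s, h). expo s * (indicator {0..} h * indicator {..<h / c} s * f (x + h - c * s))) \<in> borel_measurable (borel \<Otimes>\<^sub>M borel)"
      by (simp add: indicator_def)
  qed
  also have "\<dots> = (\<integral>\<^sup>+s. expo s * tail f x \<partial>lborel)"
  proof (rule nn_integral_cong)
    fix s
    have *: "(\<integral>\<^sup>+h. indicator {0..} h * indicator {..<h / c} s * f (x + h - c * s) \<partial>lborel) = tail f x" if s: "s \<ge> 0"
    proof -
      have cs: "c * s \<ge> 0" using c s by simp
      have "(\<integral>\<^sup>+h. indicator {0..} h * indicator {..<h / c} s * f (x + h - c * s) \<partial>lborel)
        = (\<integral>\<^sup>+h. indicator {c * s<..} h * f (x + h - c * s) \<partial>lborel)"
        using c cs by (intro nn_integral_cong) (auto simp: field_simps split: split_indicator)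
      also have "\<dots> = (\<integral>\<^sup>+h. indicator {c * s<..} (h + c * s) * f (x + (h + c * s) - c * s) \<partial>lborel)"
        by (rule nn_integral_translate[symmetric]) measurable
      also have "\<dots> = tail f x"
        unfolding tail_def using AE_lborel_singleton[of 0]
        by (intro nn_integral_cong_AE) (auto elim!: eventually_mono split: split_indicator)
      finally show ?thesis .
    qed
    show "(\<integral>\<^sup>+h. expo s * (indicator {0..} h * indicator {..<h / c} s * f (x + h - c * s)) \<partial>lborel) = expo s * tail f x"
    proof -
      have "(\<lambda>h. indicator {0..} h * (if s < h / c then 1 else 0) * f (x + h - c * s)) \<in> borel_measurable borel"
        by measurable
      then have [measurable]: "(\<lambda>h. indicator {0..} h * indicator {..<h / c} s * f (x + h - c * s)) \<in> borel_measurable borel"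
        by (simp add: indicator_def)
      show ?thesis
        using * by (cases "s \<ge> 0") (simp_all add: nn_integral_cmult expo_def)
    qed
  qed
  also have "\<dots> = tail f x" by (simp add: nn_integral_multc nn_integral_expo)
  finally show ?thesis .
qed

lemma tail_le: "f \<in> borel_measurable borel \<Longrightarrow> tail f x \<le> (\<integral>\<^sup>+x. f x \<partial>lborel)"
proof -
  assume [measurable]: "f \<in> borel_measurable borel"
  have "tail f x \<le> (\<integral>\<^sup>+s. f (s + x) \<partial>lborel)"
    unfolding tail_def by (intro nn_integral_mono) (auto split: split_indicator simp: add.commute)
  then show ?thesis by (simp add: nn_integral_translate)
qed

lemma tail_add_tail_reflect:
  assumes [measurable]: "f \<in> borel_measurable borel"
  shows "tail f 0 + tail (\<lambda>x. f (- x)) 0 = (\<integral>\<^sup>+x. f x \<partial>lborel)"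
proof -
  have "tail (\<lambda>x. f (- x)) 0 = (\<integral>\<^sup>+s. indicator {..0} (- s) * f (- s) \<partial>lborel)"
    unfolding tail_0 by (intro nn_integral_cong) (auto split: split_indicator)
  also have "\<dots> = (\<integral>\<^sup>+s. indicator {..0} s * f s \<partial>lborel)"
    by (rule nn_integral_reflect) measurable
  finally have "tail f 0 + tail (\<lambda>x. f (- x)) 0 = (\<integral>\<^sup>+s. indicator {0..} s * f s + indicator {..0} s * f s \<partial>lborel)"
    unfolding tail_0 by (simp add: nn_integral_add)
  also have "\<dots> = (\<integral>\<^sup>+x. f x \<partial>lborel)"
    using AE_lborel_singleton[of 0]
    by (intro nn_integral_cong_AE) (auto elim!: eventually_mono split: split_indicator)
  finally show ?thesis .
qed

lemma emeasure_lborel_nonneg: "emeasure lborel {0::real..} = \<infinity>"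
proof -
  have "tail (\<lambda>_. 1) 0 = emeasure lborel {0::real..}" by (simp add: tail_0)
  then have "emeasure lborel {0::real..} + emeasure lborel {0::real..} = \<infinity>"
    using tail_add_tail_reflect[of "\<lambda>_. 1"] by simp
  then show ?thesis by (auto simp: ennreal_add_eq_top)
qed

text \<open>
  Equality would force \<open>f (- u)\<close> to be at least a positive constant for almost all \<open>u \<ge> 0\<close>,
  contradicting integrability.
\<close>

lemma log_concave_smear_tail_less:
  assumes f: "log_concave f" and c: "c > 0" and fin: "(\<integral>\<^sup>+x. f x \<partial>lborel) < \<infinity>"
    and P: "tail f 0 \<noteq> 0" and Q: "tail (tail f) 0 < \<infinity>"
  shows "smear c f 0 * tail (tail (smear c f)) 0 < tail (smear c f) 0 * tail (smear c f) 0"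
proof -
  note [measurable] = log_concave_measurable[OF f]
  let ?g = "smear c f"
  have "tail ?g 0 \<le> (\<integral>\<^sup>+x. smear c f x \<partial>lborel)" by (rule tail_le) measurable
  also have "\<dots> = (\<integral>\<^sup>+x. f x \<partial>lborel)"
    using nn_integral_smear[of f "\<lambda>_. 1" c] by (simp add: nn_integral_multc nn_integral_expo)
  finally have Pg: "tail ?g 0 < \<infinity>" using fin by simp
  then have g0: "?g 0 < \<infinity>"
    unfolding tail_smear_pos[OF log_concave_measurable[OF f] c] using c
    by (auto simp: ennreal_mult_less_top)
  have tt: "tail (tail ?g) 0 = ennreal c * tail ?g 0 + tail (tail f) 0"
  proof -
    have "tail (tail ?g) 0 = (\<integral>\<^sup>+s. ennreal c * (indicator {0..} s * ?g s) + indicator {0..} s * tail f s \<partial>lborel)"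
      unfolding tail_def[of "tail ?g"] by (simp add: tail_smear_pos[OF _ c] distrib_left mult_ac)
    then show ?thesis by (simp add: nn_integral_add nn_integral_cmult tail_0)
  qed
  \<comment> \<open>By the relation between \<open>tail ?g\<close>, \<open>?g\<close> and
    \<open>tail f\<close>, each side of the goal is the finite term
    \<open>ennreal c * ?g 0 * tail ?g 0\<close> plus the corresponding side of \<open>key\<close>.
    The inequality \<open>key\<close> is \<open>log_concave_tail_ineq\<close> at
    \<open>- c * s\<close>, averaged over \<open>s\<close>.\<close>
  have key: "?g 0 * tail (tail f) 0 < tail ?g 0 * tail f 0"
  proof -
    have "(\<integral>\<^sup>+s. expo s * f (0 - c * s) * tail (tail f) 0 \<partial>lborel) < (\<integral>\<^sup>+s. expo s * tail f (0 - c * s) * tail f 0 \<partial>lborel)"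
    proof (rule nn_integral_less)
      show "(\<integral>\<^sup>+s. expo s * f (0 - c * s) * tail (tail f) 0 \<partial>lborel) \<noteq> \<infinity>"
        using g0 Q by (simp add: nn_integral_multc smear_def[of c f 0, simplified, symmetric] ennreal_mult_eq_top_iff less_top)
      show "AE s in lborel. expo s * f (0 - c * s) * tail (tail f) 0 \<le> expo s * tail f (0 - c * s) * tail f 0"
      proof (rule AE_I2)
        fix s show "expo s * f (0 - c * s) * tail (tail f) 0 \<le> expo s * tail f (0 - c * s) * tail f 0"
          using log_concave_tail_ineq[OF f, of "0 - c * s"] c
          by (cases "s \<ge> 0") (auto simp: expo_def mult.assoc intro!: mult_left_mono)
      qed
      show "\<not> (AE s in lborel. expo s * tail f (0 - c * s) * tail f 0 \<le> expo s * f (0 - c * s) * tail (tail f) 0)"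
      proof
        assume "AE s in lborel. expo s * tail f (0 - c * s) * tail f 0 \<le> expo s * f (0 - c * s) * tail (tail f) 0"
        then have ae: "AE s in lborel. indicator {0..} s * (tail f 0 * tail f 0) \<le> f (0 - c * s) * tail (tail f) 0"
        proof (rule eventually_mono)
          fix s assume *: "expo s * tail f (0 - c * s) * tail f 0 \<le> expo s * f (0 - c * s) * tail (tail f) 0"
          show "indicator {0..} s * (tail f 0 * tail f 0) \<le> f (0 - c * s) * tail (tail f) 0"
          proof (cases "s \<ge> 0")
            case True
            have "tail f (0 - c * s) = (\<integral>\<^sup>+r. indicator {0..<c * s} r * f (0 - c * s + r) \<partial>lborel) + tail f (0 - c * s + c * s)"
              using c True by (intro tail_add) auto
            then have "tail f 0 \<le> tail f (0 - c * s)" by simp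
            then have 1: "tail f 0 * tail f 0 \<le> tail f (0 - c * s) * tail f 0" by (rule mult_right_mono) simp
            have "ennreal (exp (- s)) * (tail f (0 - c * s) * tail f 0) \<le> ennreal (exp (- s)) * (f (0 - c * s) * tail (tail f) 0)"
              using * True by (simp add: expo_def mult.assoc)
            then have "ennreal (exp s) * (ennreal (exp (- s)) * (tail f (0 - c * s) * tail f 0))
                \<le> ennreal (exp s) * (ennreal (exp (- s)) * (f (0 - c * s) * tail (tail f) 0))"
              by (rule mult_left_mono) simp
            moreover have "ennreal (exp s) * (ennreal (exp (- s)) * z) = z" for z
              by (simp flip: mult.assoc ennreal_mult exp_add)
            ultimately have "tail f (0 - c * s) * tail f 0 \<le> f (0 - c * s) * tail (tail f) 0" by simp
            with 1 show ?thesis using True by (auto intro: order.trans)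
          qed simp
        qed
        have "\<infinity> = (\<integral>\<^sup>+s. indicator {0..} s * (tail f 0 * tail f 0) \<partial>(lborel :: real measure))"
          using P by (simp add: nn_integral_multc emeasure_lborel_nonneg ennreal_top_mult)
        also have "\<dots> \<le> (\<integral>\<^sup>+s. f (0 - c * s) * tail (tail f) 0 \<partial>lborel)"
          by (rule nn_integral_mono_AE[OF ae])
        also have "\<dots> = (\<integral>\<^sup>+s. f (0 - c * s) \<partial>lborel) * tail (tail f) 0"
          by (simp add: nn_integral_multc)
        also have "\<dots> < \<infinity>"
        proof -
          have "(\<integral>\<^sup>+x. f x \<partial>lborel) = ennreal c * (\<integral>\<^sup>+s. f (0 - c * s) \<partial>lborel)"
            using nn_integral_real_affine[of f "- c" 0] c by simp
          with fin c Q show ?thesis by (auto simp: ennreal_mult_less_top)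
        qed
        finally show False by simp
      qed
    qed measurable
    then show ?thesis
      unfolding tail_smear[OF log_concave_measurable[OF f]] smear_def
      by (simp add: nn_integral_multc)
  qed
  have "?g 0 * tail (tail ?g) 0 = ennreal c * ?g 0 * tail ?g 0 + ?g 0 * tail (tail f) 0"
    unfolding tt by (simp add: distrib_left mult_ac)
  also have "\<dots> < ennreal c * ?g 0 * tail ?g 0 + tail ?g 0 * tail f 0"
    using key g0 Pg by (simp add: ennreal_add_left_cancel_less ennreal_mult_eq_top_iff less_top)
  also have "\<dots> = tail ?g 0 * tail ?g 0"
    using tail_smear_pos[OF log_concave_measurable[OF f] c, of 0] by (simp add: distrib_left mult_ac)
  finally show ?thesis .
qed

subsection \<open>Log-concave densities at their mean\<close>

text \<open>Weighting the bounds on \<open>A\<close> and \<open>B\<close> with \<open>q\<close> and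
  \<open>p\<close> lets \<open>A + B = 1 / 2\<close> enter:
  \<open>p * q / 2 \<le> m\<^sup>2\<close>. The product of the two bounds on \<open>F * m\<close> is
  \<open>F\<^sup>2 * m\<^sup>2 \<le> (p * q)\<^sup>2\<close>, so \<open>m\<close> drops out and
  \<open>F\<^sup>2 / 2 \<le> p * q \<le> 1 / 4\<close>. One strict factor makes the product strict
  as long as the other one is positive.\<close>

lemma density_ineq_real:
  fixes p q m A B F :: real
  assumes pq: "p + q = 1" and AB: "A + B = 1 / 2" and A: "A * p \<le> m\<^sup>2" and B: "B * q \<le> m\<^sup>2"
    and Fp: "F * m \<le> p\<^sup>2" and Fq: "F * m \<le> q\<^sup>2" and m: "m > 0" and nn: "p \<ge> 0" "q \<ge> 0" "F \<ge> 0"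
  shows "F \<le> 1 / sqrt 2" and "F * m < p\<^sup>2 \<Longrightarrow> F < 1 / sqrt 2"
proof -
  have "p * q / 2 = (A + B) * (p * q)" using AB by simp
  also have "\<dots> = (A * p) * q + (B * q) * p" by (simp add: algebra_simps)
  also have "\<dots> \<le> m\<^sup>2 * q + m\<^sup>2 * p" by (intro add_mono mult_right_mono A B nn)
  also have "\<dots> = m\<^sup>2" using pq by (simp flip: distrib_left add: add.commute)
  finally have pqm: "p * q / 2 \<le> m\<^sup>2" .
  have "p * q \<le> ((p + q) / 2)\<^sup>2" using zero_le_power2[of "p - q"] by (simp add: power2_eq_square field_simps)
  then have pq4: "p * q \<le> 1 / 4" using pq by (simp add: power2_eq_square)
  have half: "F\<^sup>2 \<le> 1 / 2 \<Longrightarrow> F \<le> 1 / sqrt 2" "F\<^sup>2 < 1 / 2 \<Longrightarrow> F < 1 / sqrt 2"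
    using real_le_rsqrt[of F "1 / 2"] real_less_rsqrt[of F "1 / 2"] by (auto simp: real_sqrt_divide)
  have Fm: "F * m \<ge> 0" using m nn by simp
  have FF: "(F * m) * (F * m) \<le> p\<^sup>2 * q\<^sup>2" by (intro mult_mono Fp Fq) (use Fm in auto)
  have mp: "m\<^sup>2 > 0" using m by simp
  show "F \<le> 1 / sqrt 2"
  \<comment> \<open>In the degenerate case \<open>p * q\<close> cannot be cancelled, but the product
    bound then forces \<open>F = 0\<close>.\<close>
  proof (cases "p * q = 0")
    case True
    then have "(F * m) * (F * m) \<le> 0" using FF by (auto simp flip: power_mult_distrib)
    then have "F = 0" using m nn by (auto simp: mult_le_0_iff)
    then show ?thesis by simp
  next
    case False
    then have pos: "p * q > 0" using nn by (simp add: less_le)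
    have "F\<^sup>2 * (p * q / 2) \<le> F\<^sup>2 * m\<^sup>2" by (intro mult_left_mono pqm) simp
    also have "\<dots> \<le> (p * q) * (p * q)" using FF by (simp add: power2_eq_square mult_ac)
    finally have "F\<^sup>2 / 2 * (p * q) \<le> (p * q) * (p * q)" by simp
    then have "F\<^sup>2 / 2 \<le> p * q" using pos by (rule mult_right_le_imp_le)
    then show ?thesis using pq4 by (intro half) simp
  qed
  assume less: "F * m < p\<^sup>2"
  show "F < 1 / sqrt 2"
  proof (cases "q = 0")
    case True
    then have "F * m \<le> 0" using Fq by simp
    then have "F = 0" using m nn by (simp add: mult_le_0_iff)
    then show ?thesis by simp
  next
    case False
    have p0: "p \<noteq> 0" using less Fm by auto
    then have pos: "p * q > 0" using nn False by (simp add: less_le)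
    have "(F * m) * (F * m) \<le> (F * m) * q\<^sup>2" by (intro mult_left_mono Fq Fm)
    also have "\<dots> < p\<^sup>2 * q\<^sup>2" by (intro mult_strict_right_mono less) (use False in simp)
    finally have "(F * m) * (F * m) < p\<^sup>2 * q\<^sup>2" .
    moreover have "F\<^sup>2 * (p * q / 2) \<le> F\<^sup>2 * m\<^sup>2" by (intro mult_left_mono pqm) simp
    ultimately have "F\<^sup>2 * (p * q / 2) < (p * q) * (p * q)" by (simp add: power2_eq_square mult_ac)
    then have "F\<^sup>2 / 2 * (p * q) < (p * q) * (p * q)" by simp
    then have "F\<^sup>2 / 2 < p * q" by (rule mult_right_less_imp_less) (use pos in simp)
    then show ?thesis using pq4 by (intro half) simp
  qed
qed

text \<open>\<open>has_mean_var\<close> speaks only of second moments; the one about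
  \<open>- 1\<close> dominates the half-line first moment through
  \<open>s \<le> (s + 1)\<^sup>2\<close>.\<close>

lemma tail_tail_finite:
  assumes f: "has_mean_var f \<mu> v" and [measurable]: "f \<in> borel_measurable borel"
  shows "tail (tail f) 0 < \<infinity>"
proof -
  have "tail (tail f) 0 \<le> (\<integral>\<^sup>+x. ennreal ((x + 1)\<^sup>2) * f x \<partial>lborel)"
    unfolding tail_tail_0[OF assms(2)]
  proof (rule nn_integral_mono)
    fix s :: real
    have "s \<le> (s + 1)\<^sup>2" using zero_le_power2[of "s + 1 / 2"] by (simp add: power2_eq_square algebra_simps)
    then have "ennreal s * f s \<le> ennreal ((s + 1)\<^sup>2) * f s" by (intro mult_right_mono ennreal_leI) auto
    then show "ennreal s * (indicator {0..} s * f s) \<le> ennreal ((s + 1)\<^sup>2) * f s" by (auto split: split_indicator)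
  qed
  then show ?thesis using f by (auto simp: has_mean_var_def elim!: order.strict_trans1)
qed

lemma log_concave_density_at_mean:
  assumes f: "log_concave f" and mv: "has_mean_var f 0 1"
  shows "f 0 \<le> ennreal (1 / sqrt 2)"
    and "f 0 * tail (tail f) 0 < tail f 0 * tail f 0 \<Longrightarrow> f 0 < ennreal (1 / sqrt 2)"
proof -
  note [measurable] = log_concave_measurable[OF f]
  let ?g = "\<lambda>x. f (- x)"
  note g = log_concave_reflect[OF f]
  have int: "(\<integral>\<^sup>+x. f x \<partial>lborel) = 1" using mv by (simp add: has_mean_var_def)
  have sq: "(\<integral>\<^sup>+x. ennreal (x\<^sup>2) * f x \<partial>lborel) = 1"
    using mv[unfolded has_mean_var_def, THEN conjunct2, THEN conjunct2, THEN spec, of 0] by simp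
  have sq1: "(\<integral>\<^sup>+x. ennreal ((x + 1)\<^sup>2) * f x \<partial>lborel) = 2"
    using mv[unfolded has_mean_var_def, THEN conjunct2, THEN conjunct2, THEN spec, of 1] by simp
  define p q m where "p = tail f 0" and "q = tail ?g 0" and "m = tail (tail f) 0"
  define A B where "A = tail (tail (tail f)) 0" and "B = tail (tail (tail ?g)) 0"
  have pq: "p + q = 1" unfolding p_def q_def using tail_add_tail_reflect[of f] int by simp
  have mfin: "m < \<infinity>" unfolding m_def by (rule tail_tail_finite[OF mv]) measurable
  have m': "tail (tail ?g) 0 = (\<integral>\<^sup>+s. ennreal (- s) * (indicator {..0} s * f s) \<partial>lborel)"
  proof -
    have "tail (tail ?g) 0 = (\<integral>\<^sup>+s. ennreal (- (- s)) * (indicator {..0} (- s) * f (- s)) \<partial>lborel)"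
      by (subst tail_tail_0) (auto intro!: nn_integral_cong split: split_indicator)
    also have "\<dots> = (\<integral>\<^sup>+s. ennreal (- s) * (indicator {..0} s * f s) \<partial>lborel)"
      by (rule nn_integral_reflect) measurable
    finally show ?thesis .
  qed
  have B': "B = (\<integral>\<^sup>+s. ennreal (s\<^sup>2 / 2) * (indicator {..0} s * f s) \<partial>lborel)"
  proof -
    have "B = (\<integral>\<^sup>+s. ennreal ((- s)\<^sup>2 / 2) * (indicator {..0} (- s) * f (- s)) \<partial>lborel)"
      unfolding B_def by (subst tail_tail_tail_0) (auto intro!: nn_integral_cong split: split_indicator)
    also have "\<dots> = (\<integral>\<^sup>+s. ennreal (s\<^sup>2 / 2) * (indicator {..0} s * f s) \<partial>lborel)"
      by (rule nn_integral_reflect) measurable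
    finally show ?thesis .
  qed
  \<comment> \<open>The mean is read off from the second moment about \<open>- 1\<close>. With
    positive and negative parts,
    \<open>(x + 1)\<^sup>2 + 2 * x_neg = x\<^sup>2 + 1 + 2 * x_pos\<close> has only nonnegative
    terms. By mean \<open>0\<close> and variance \<open>1\<close>, both
    \<open>(x + 1)\<^sup>2\<close> and \<open>x\<^sup>2 + 1\<close> integrate to \<open>2\<close>,
    which cancels.\<close>
  have mm: "tail (tail ?g) 0 = m"
  proof -
    have "2 + 2 * tail (tail ?g) 0 = (\<integral>\<^sup>+x. ennreal ((x + 1)\<^sup>2) * f x + 2 * (ennreal (- x) * (indicator {..0} x * f x)) \<partial>lborel)"
      by (simp add: nn_integral_add nn_integral_cmult sq1 m')
    also have "\<dots> = (\<integral>\<^sup>+x. ennreal (x\<^sup>2) * f x + f x + 2 * (ennreal x * (indicator {0..} x * f x)) \<partial>lborel)"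
    proof (rule nn_integral_cong)
      fix x :: real
      have "ennreal ((x + 1)\<^sup>2) + 2 * (ennreal (- x) * indicator {..0} x) = ennreal (x\<^sup>2) + 1 + 2 * (ennreal x * indicator {0..} x)"
      proof (cases "x \<ge> 0")
        case True
        have "ennreal ((x + 1)\<^sup>2) = ennreal (x\<^sup>2 + 1 + 2 * x)" by (simp add: power2_eq_square algebra_simps)
        also have "\<dots> = ennreal (x\<^sup>2) + 1 + 2 * ennreal x" using True by (simp add: ennreal_mult)
        finally show ?thesis using True by (auto split: split_indicator)
      next
        case False
        have "ennreal ((x + 1)\<^sup>2) + 2 * ennreal (- x) = ennreal ((x + 1)\<^sup>2 + 2 * (- x))"
          by (subst ennreal_plus) (use False ennreal_mult[of 2 "- x"] in auto)
        also have "(x + 1)\<^sup>2 + 2 * (- x) = x\<^sup>2 + 1" by (simp add: power2_eq_square algebra_simps)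
        finally show ?thesis using False by simp
      qed
      then have "(ennreal ((x + 1)\<^sup>2) + 2 * (ennreal (- x) * indicator {..0} x)) * f x
        = (ennreal (x\<^sup>2) + 1 + 2 * (ennreal x * indicator {0..} x)) * f x" by simp
      then show "ennreal ((x + 1)\<^sup>2) * f x + 2 * (ennreal (- x) * (indicator {..0} x * f x))
        = ennreal (x\<^sup>2) * f x + f x + 2 * (ennreal x * (indicator {0..} x * f x))"
        by (simp add: algebra_simps)
    qed
    also have "\<dots> = 2 + 2 * m"
      unfolding m_def tail_tail_0[OF log_concave_measurable[OF f]]
      by (simp add: nn_integral_add nn_integral_cmult sq int)
    finally have "2 * tail (tail ?g) 0 = 2 * m" by (simp add: ennreal_add_left_cancel)
    then show ?thesis by (simp add: ennreal_mult_cancel_left)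
  qed
  have AB: "A + B = ennreal (1 / 2)"
  proof -
    have "A + B = (\<integral>\<^sup>+s. ennreal (s\<^sup>2 / 2) * (indicator {0..} s * f s) + ennreal (s\<^sup>2 / 2) * (indicator {..0} s * f s) \<partial>lborel)"
      unfolding A_def B' by (simp add: tail_tail_tail_0 nn_integral_add)
    also have "\<dots> = (\<integral>\<^sup>+s. ennreal (1 / 2) * (ennreal (s\<^sup>2) * f s) \<partial>lborel)"
    proof (rule nn_integral_cong)
      fix s :: real
      have "ennreal (s\<^sup>2 / 2) = ennreal (1 / 2) * ennreal (s\<^sup>2)" by (subst ennreal_mult[symmetric]) auto
      then show "ennreal (s\<^sup>2 / 2) * (indicator {0..} s * f s) + ennreal (s\<^sup>2 / 2) * (indicator {..0} s * f s)
        = ennreal (1 / 2) * (ennreal (s\<^sup>2) * f s)" by (cases "s = 0") (auto split: split_indicator simp: mult.assoc)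
    qed
    also have "\<dots> = ennreal (1 / 2)" by (simp add: nn_integral_cmult sq)
    finally show ?thesis .
  qed
  have Ap: "A * p \<le> m * m"
    using log_concave_tail_ineq[OF log_concave_tail[OF f], of 0] by (simp add: A_def p_def m_def mult_ac)
  have Bq: "B * q \<le> m * m"
    using log_concave_tail_ineq[OF log_concave_tail[OF g], of 0] by (simp add: B_def q_def mm mult_ac)
  have Fp: "f 0 * m \<le> p * p"
    using log_concave_tail_ineq[OF f, of 0] by (simp add: p_def m_def)
  have Fq: "f 0 * m \<le> q * q"
    using log_concave_tail_ineq[OF g, of 0] by (simp add: q_def mm)
  \<comment> \<open>As both one-sided first moments equal \<open>m\<close>, the case
    \<open>m = 0\<close> would leave no mass away from \<open>0\<close>, against variance
    \<open>1\<close>.\<close>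
  have m0: "m \<noteq> 0"
  proof
    assume "m = 0"
    then have "AE s in lborel. ennreal s * (indicator {0..} s * f s) = 0"
      unfolding m_def tail_tail_0[OF log_concave_measurable[OF f]] by (subst (asm) nn_integral_0_iff_AE) auto
    moreover have "AE s in lborel. ennreal (- s) * (indicator {..0} s * f s) = 0"
      using \<open>m = 0\<close> unfolding mm[symmetric] m' by (subst (asm) nn_integral_0_iff_AE) auto
    ultimately have "AE s in lborel. ennreal (s\<^sup>2) * f s = 0"
      by eventually_elim (auto split: split_indicator_asm)
    then have "(\<integral>\<^sup>+x. ennreal (x\<^sup>2) * f x \<partial>lborel) = 0" by (simp add: nn_integral_0_iff_AE)
    with sq show False by simp
  qed
  have pfin: "p \<noteq> \<infinity>" "q \<noteq> \<infinity>" using pq by auto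
  have ABfin: "A \<noteq> \<infinity>" "B \<noteq> \<infinity>"
  proof -
    have "A + B < top" unfolding AB by (rule ennreal_less_top)
    then show "A \<noteq> \<infinity>" "B \<noteq> \<infinity>" by auto
  qed
  have Ffin: "f 0 \<noteq> \<infinity>" using Fp m0 pfin by (auto simp: ennreal_top_mult top_unique ennreal_mult_eq_top_iff)
  obtain p' where p': "p = ennreal p'" "p' \<ge> 0" using pfin by (cases p) auto
  obtain q' where q': "q = ennreal q'" "q' \<ge> 0" using pfin by (cases q) auto
  obtain m' where m': "m = ennreal m'" "m' \<ge> 0" using mfin by (cases m) auto
  obtain A' where A': "A = ennreal A'" "A' \<ge> 0" using ABfin by (cases A) auto
  obtain B' where B': "B = ennreal B'" "B' \<ge> 0" using ABfin by (cases B) auto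
  obtain F where F: "f 0 = ennreal F" "F \<ge> 0" using Ffin by (cases "f 0") auto
  have "ennreal (A' + B') = ennreal (1 / 2)" using AB A' B' by simp
  then have AB': "A' + B' = 1 / 2" using A'(2) B'(2) by (subst (asm) ennreal_inj) auto
  have r: "p' + q' = 1" "A' + B' = 1 / 2" "A' * p' \<le> m'\<^sup>2" "B' * q' \<le> m'\<^sup>2" "F * m' \<le> p'\<^sup>2" "F * m' \<le> q'\<^sup>2" "m' > 0"
    using pq AB' Ap Bq Fp Fq m0 p'(2) q'(2) m'(2) A'(2) B'(2) F(2)
    unfolding p'(1) q'(1) m'(1) A'(1) B'(1) F(1)
    by (auto simp: power2_eq_square less_le simp flip: ennreal_mult ennreal_plus ennreal_1)
  show "f 0 \<le> ennreal (1 / sqrt 2)"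
    unfolding F by (intro ennreal_leI density_ineq_real(1)[OF r p'(2) q'(2) F(2)])
  assume "f 0 * tail (tail f) 0 < tail f 0 * tail f 0"
  then have "F * m' < p'\<^sup>2"
    using p'(2) m'(2) F(2) unfolding F(1) m_def[symmetric] p_def[symmetric] p'(1) m'(1)
    by (simp add: power2_eq_square ennreal_less_iff flip: ennreal_mult)
  then show "f 0 < ennreal (1 / sqrt 2)"
    unfolding F(1) using density_ineq_real(2)[OF r p'(2) q'(2) F(2)] F(2) by (simp add: ennreal_less_iff)
qed

subsection \<open>Sums of scaled exponential variables\<close>

lemma log_concave_smear_at_mean:
  assumes f: "log_concave f" and mv: "has_mean_var f \<mu> v" and c: "c > 0" and P: "tail f 0 \<noteq> 0"
    and mv': "has_mean_var (smear c f) 0 1"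
  shows "smear c f 0 < ennreal (1 / sqrt 2)"
proof (rule log_concave_density_at_mean(2)[OF log_concave_smear[OF f] mv'])
  show "smear c f 0 * tail (tail (smear c f)) 0 < tail (smear c f) 0 * tail (smear c f) 0"
    using mv tail_tail_finite[OF mv log_concave_measurable[OF f]]
    by (intro log_concave_smear_tail_less[OF f c _ P]) (auto simp: has_mean_var_def)
qed

text \<open>An exponential variable with positive coefficient exceeds every bound with positive
  probability. Formally, \<open>smear_add\<close> applied to \<open>tail f\<close> bounds the tail
  at \<open>0\<close> below by a positive multiple of the tail at \<open>- n\<close>; if it were
  zero, all of these would vanish, and with them the total mass.\<close>

lemma tail_smear_nonzero:
  assumes [measurable]: "f \<in> borel_measurable borel" and c: "c > 0" and "(\<integral>\<^sup>+x. f x \<partial>lborel) \<noteq> 0"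
  shows "tail (smear c f) 0 \<noteq> 0"
proof
  assume z: "tail (smear c f) 0 = 0"
  have "tail (smear c f) (- real n) = 0" for n
    using smear_add[of "tail f" c "real n" "- real n"] c z by (simp add: tail_smear)
  then have "AE s in lborel. indicator {- real n..} s * smear c f s = 0" for n
  proof -
    have "(\<integral>\<^sup>+s. indicator {- real n..} s * smear c f s \<partial>lborel)
      = (\<integral>\<^sup>+s. indicator {- real n..} (s + - real n) * smear c f (s + - real n) \<partial>lborel)"
      by (rule nn_integral_translate[symmetric]) measurable
    also have "\<dots> = tail (smear c f) (- real n)"
      unfolding tail_def by (intro nn_integral_cong) (auto split: split_indicator)
    finally show ?thesis using \<open>\<And>n. tail (smear c f) (- real n) = 0\<close>
      by (simp add: nn_integral_0_iff_AE)
  qed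
  then have "AE s in lborel. \<forall>n. indicator {- real n..} s * smear c f s = 0"
    unfolding AE_all_countable by blast
  then have "AE s in lborel. smear c f s = 0"
  proof eventually_elim
    case (elim s)
    obtain n where "- s \<le> real n" using real_arch_simple by blast
    with elim[rule_format, of n] show ?case by (simp add: indicator_def split: if_splits)
  qed
  then have "(\<integral>\<^sup>+x. smear c f x \<partial>lborel) = 0" by (simp add: nn_integral_0_iff_AE)
  with assms(3) nn_integral_smear[of f "\<lambda>_. 1" c] show False
    by (simp add: nn_integral_multc nn_integral_expo)
qed

interpretation lborel_prod: product_sigma_finite "\<lambda>_. lborel :: real measure"
  by standard

text \<open>A density of the sum of \<open>a i * E i\<close> over \<open>i \<in> I \<union> {j}\<close>, where the \<open>E i\<close> are independent
  standard exponential variables; the variable \<open>E j\<close> is the one that is integrated out.\<close>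

definition sum_density :: "('i \<Rightarrow> real) \<Rightarrow> 'i \<Rightarrow> 'i set \<Rightarrow> real \<Rightarrow> ennreal" where
  "sum_density a j I t =
     (\<integral>\<^sup>+x. (\<Prod>i\<in>I. expo (x i)) * expo_density (a j) (t - (\<Sum>i\<in>I. a i * x i)) \<partial>PiM I (\<lambda>_. lborel))"

lemma sum_density_empty: "sum_density a j {} = expo_density (a j)"
  by (simp add: fun_eq_iff sum_density_def PiM_empty nn_integral_count_space_finite)

text \<open>Fubini splits off the coordinate \<open>i\<close>, so one more summand is one more
  convolution. Log-concavity, mean and variance of the whole sum then follow by induction.\<close>

lemma sum_density_insert:
  assumes I: "finite I" "i \<notin> I"
  shows "sum_density a j (insert i I) = smear (a i) (sum_density a j I)"
proof
  fix t
  have "sum_density a j (insert i I) t = (\<integral>\<^sup>+y. (\<integral>\<^sup>+x. (\<Prod>k\<in>insert i I. expo ((x(i := y)) k))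
    * expo_density (a j) (t - (\<Sum>k\<in>insert i I. a k * (x(i := y)) k)) \<partial>PiM I (\<lambda>_. lborel)) \<partial>lborel)"
    unfolding sum_density_def by (rule lborel_prod.product_nn_integral_insert_rev[OF I]) measurable
  also have "\<dots> = (\<integral>\<^sup>+y. (\<integral>\<^sup>+x. expo y * ((\<Prod>k\<in>I. expo (x k))
    * expo_density (a j) (t - a i * y - (\<Sum>k\<in>I. a k * x k))) \<partial>PiM I (\<lambda>_. lborel)) \<partial>lborel)"
  proof (intro nn_integral_cong)
    fix y x
    have "(\<Prod>k\<in>I. expo ((x(i := y)) k)) = (\<Prod>k\<in>I. expo (x k))"
      using I by (intro prod.cong) auto
    moreover have "(\<Sum>k\<in>I. a k * (x(i := y)) k) = (\<Sum>k\<in>I. a k * x k)"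
      using I by (intro sum.cong) auto
    ultimately show "(\<Prod>k\<in>insert i I. expo ((x(i := y)) k))
      * expo_density (a j) (t - (\<Sum>k\<in>insert i I. a k * (x(i := y)) k))
      = expo y * ((\<Prod>k\<in>I. expo (x k)) * expo_density (a j) (t - a i * y - (\<Sum>k\<in>I. a k * x k)))"
      using I by (simp add: mult.assoc diff_diff_eq)
  qed
  also have "\<dots> = smear (a i) (sum_density a j I) t"
    unfolding smear_def sum_density_def by (intro nn_integral_cong nn_integral_cmult) measurable
  finally show "sum_density a j (insert i I) t = smear (a i) (sum_density a j I) t" .
qed

lemma sum_density_properties:
  assumes "finite I" "j \<notin> I" "a j \<noteq> 0"
  shows "log_concave (sum_density a j I) \<and>
    has_mean_var (sum_density a j I) (\<Sum>i\<in>insert j I. a i) (\<Sum>i\<in>insert j I. (a i)\<^sup>2)"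
  using assms(1,2)
proof (induction I)
  case empty
  then show ?case
    using assms(3) by (simp add: sum_density_empty log_concave_expo_density has_mean_var_expo_density)
next
  case (insert i I)
  then have IH: "log_concave (sum_density a j I)"
      "has_mean_var (sum_density a j I) (\<Sum>i\<in>insert j I. a i) (\<Sum>i\<in>insert j I. (a i)\<^sup>2)"
    by auto
  have "(\<Sum>k\<in>insert j (insert i I). a k) = (\<Sum>k\<in>insert j I. a k) + a i"
    "(\<Sum>k\<in>insert j (insert i I). (a k)\<^sup>2) = (\<Sum>k\<in>insert j I. (a k)\<^sup>2) + (a i)\<^sup>2"
    using insert by (auto simp: insert_commute[of j i])
  then show ?case
    using log_concave_smear[OF IH(1)] has_mean_var_smear[OF IH(2) log_concave_measurable[OF IH(1)]] insert.hyps
    by (simp add: sum_density_insert)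
qed

lemma sum_density_zero_coefficients:
  assumes "finite J" "finite I" "J \<inter> I = {}" "\<And>i. i \<in> J \<Longrightarrow> a i = 0"
  shows "sum_density a j (J \<union> I) = sum_density a j I"
  using assms by (induction J) (auto simp: sum_density_insert smear_0)

context
  fixes a :: "'i \<Rightarrow> real" and U :: "'i set" and j :: 'i
  assumes U: "finite U" "j \<in> U" and aj: "a j \<noteq> 0"
    and sum0: "(\<Sum>i\<in>U. a i) = 0" and sum1: "(\<Sum>i\<in>U. (a i)\<^sup>2) = 1"
begin

lemma sum_density_normalized:
  "log_concave (sum_density a j (U - {j}))" "has_mean_var (sum_density a j (U - {j})) 0 1"
  using sum_density_properties[of "U - {j}" j a] U aj sum0 sum1 by (auto simp: insert_absorb)

lemma sum_density_le: "sum_density a j (U - {j}) 0 \<le> ennreal (1 / sqrt 2)"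
  by (intro log_concave_density_at_mean sum_density_normalized)

text \<open>The two positive coefficients act differently: \<open>a k\<close> makes the tail at
  \<open>0\<close> nonzero before the last convolution, and the last convolution, with
  \<open>a i\<close>, then yields the strict inequality.\<close>

lemma sum_density_less:
  assumes "i \<in> U" "k \<in> U" "i \<noteq> k" "a i > 0" "a k > 0" "a j < 0"
  shows "sum_density a j (U - {j}) 0 < ennreal (1 / sqrt 2)"
proof -
  let ?I = "U - {j} - {i} - {k}"
  have ij: "i \<noteq> j" "k \<noteq> j" using assms by auto
  have eq1: "sum_density a j (U - {j}) = smear (a i) (sum_density a j (U - {j} - {i}))"
    using sum_density_insert[of "U - {j} - {i}" i a j] U assms ij by (simp add: insert_absorb)
  have eq2: "sum_density a j (U - {j} - {i}) = smear (a k) (sum_density a j ?I)"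
    using sum_density_insert[of ?I k a j] U assms ij by (simp add: insert_absorb)
  have p1: "log_concave (sum_density a j (U - {j} - {i}))"
    "has_mean_var (sum_density a j (U - {j} - {i})) (\<Sum>l\<in>insert j (U - {j} - {i}). a l) (\<Sum>l\<in>insert j (U - {j} - {i}). (a l)\<^sup>2)"
    using sum_density_properties[of "U - {j} - {i}" j a] U aj by auto
  have p2: "log_concave (sum_density a j ?I)" "(\<integral>\<^sup>+x. sum_density a j ?I x \<partial>lborel) = 1"
    using sum_density_properties[of ?I j a] U aj by (auto simp: has_mean_var_def)
  have "tail (sum_density a j (U - {j} - {i})) 0 \<noteq> 0"
    unfolding eq2 using p2 assms by (intro tail_smear_nonzero log_concave_measurable) auto
  then show ?thesis
    unfolding eq1 by (intro log_concave_smear_at_mean[OF p1 assms(4)] sum_density_normalized(2)[unfolded eq1])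
qed

text \<open>Once the zero coefficients are removed, the variable is a difference of two exponentials
  divided by \<open>sqrt 2\<close>. Its density at \<open>0\<close> is the integral of
  \<open>sqrt 2 * exp (- (2 * s))\<close> over \<open>s \<ge> 0\<close>, that is,
  \<open>1 / sqrt 2\<close> times the mass of \<open>expo_density (1 / 2)\<close>.\<close>

lemma sum_density_eq:
  assumes "i \<in> U" "a i = 1 / sqrt 2" "a j = - (1 / sqrt 2)" "\<And>k. k \<in> U \<Longrightarrow> k \<noteq> i \<Longrightarrow> k \<noteq> j \<Longrightarrow> a k = 0"
  shows "sum_density a j (U - {j}) 0 = ennreal (1 / sqrt 2)"
proof -
  have "sqrt 2 > 0" by simp
  have ij: "i \<noteq> j"
  proof
    assume "i = j"
    then have "1 / sqrt 2 = - (1 / sqrt 2)" using assms by simp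
    with \<open>sqrt 2 > 0\<close> show False by (simp add: field_simps)
  qed
  have "sum_density a j (U - {j}) = sum_density a j ((U - {j} - {i}) \<union> {i})"
    using assms ij by (intro arg_cong[where f = "sum_density a j"]) auto
  also have "\<dots> = sum_density a j {i}"
    using U assms by (intro sum_density_zero_coefficients) auto
  also have "\<dots> = smear (a i) (expo_density (a j))"
    using sum_density_insert[of "{}" i a j] by (simp add: sum_density_empty)
  finally have "sum_density a j (U - {j}) 0 = (\<integral>\<^sup>+s. expo s * expo_density (a j) (0 - a i * s) \<partial>lborel)"
    by (simp add: smear_def)
  also have "\<dots> = (\<integral>\<^sup>+s. ennreal (1 / sqrt 2) * expo_density (1 / 2) s \<partial>lborel)"
  proof (rule nn_integral_cong)
    fix s :: real
    have *: "1 / \<bar>a j\<bar> = sqrt 2" "(0 - a i * s) / a j = s" using assms by auto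
    have "expo s * expo_density (a j) (0 - a i * s) = ennreal (sqrt 2 * exp (- (2 * s))) * indicator {0..} s"
      unfolding expo_density_def * expo_def
      by (auto simp: mult_exp_exp simp flip: ennreal_mult split: split_indicator)
    also have "\<dots> = ennreal (1 / sqrt 2) * expo_density (1 / 2) s"
    proof -
      have "sqrt 2 * exp (- (2 * s)) = 1 / sqrt 2 * (2 * exp (- (2 * s)))"
        by (simp add: field_simps)
      then have "ennreal (sqrt 2 * exp (- (2 * s))) = ennreal (1 / sqrt 2) * (ennreal 2 * ennreal (exp (- (2 * s))))"
        by (simp only: ennreal_mult'[symmetric] ennreal_mult''[symmetric] zero_le_divide_iff) (simp flip: ennreal_mult)
      then show ?thesis
        by (auto simp: expo_density_def expo_def mult_ac split: split_indicator)
    qed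
    finally show "expo s * expo_density (a j) (0 - a i * s) = ennreal (1 / sqrt 2) * expo_density (1 / 2) s" .
  qed
  also have "\<dots> = ennreal (1 / sqrt 2)"
    using has_mean_var_expo_density[of "1 / 2"] by (simp add: nn_integral_cmult has_mean_var_def)
  finally show ?thesis .
qed

end

subsection \<open>Lebesgue measure in orthonormal coordinates\<close>

text \<open>Serves twice: with \<open>\<rho> = 1\<close> as translation invariance, and with general
  \<open>\<rho>\<close> as homogeneity of degree \<open>card I\<close>, the source of the power
  \<open>\<rho> ^ k\<close> in the volumes of parallel slices.\<close>

lemma nn_integral_PiM_affine:
  fixes v :: "'i \<Rightarrow> real"
  assumes "finite I" "\<rho> > 0" "g \<in> borel_measurable (PiM I (\<lambda>_. lborel))"
  shows "(\<integral>\<^sup>+x. g x \<partial>PiM I (\<lambda>_. lborel))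
    = ennreal (\<rho> ^ card I) * (\<integral>\<^sup>+x. g (\<lambda>i\<in>I. \<rho> * x i + v i) \<partial>PiM I (\<lambda>_. lborel))"
  using assms
proof (induction I arbitrary: g)
  case empty
  then show ?case by (simp add: PiM_empty nn_integral_count_space_finite)
next
  case (insert i I)
  note [measurable] = insert.prems(2)
  have "(\<integral>\<^sup>+x. g x \<partial>PiM (insert i I) (\<lambda>_. lborel)) = (\<integral>\<^sup>+x. (\<integral>\<^sup>+y. g (x(i := y)) \<partial>lborel) \<partial>PiM I (\<lambda>_. lborel))"
    by (rule lborel_prod.product_nn_integral_insert[OF insert.hyps(1,2)]) measurable
  also have "\<dots> = (\<integral>\<^sup>+x. ennreal \<rho> * (\<integral>\<^sup>+y. g (x(i := \<rho> * y + v i)) \<partial>lborel) \<partial>PiM I (\<lambda>_. lborel))"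
  proof (rule nn_integral_cong)
    fix x assume x: "x \<in> space (PiM I (\<lambda>_. lborel :: real measure))"
    have "(\<lambda>y. g (x(i := y))) \<in> borel_measurable borel"
      using measurable_comp[OF measurable_component_update[OF x insert.hyps(2)] insert.prems(2)]
      by (simp add: comp_def)
    from nn_integral_real_affine[OF this, of \<rho> "v i"] insert.prems(1)
    show "(\<integral>\<^sup>+y. g (x(i := y)) \<partial>lborel) = ennreal \<rho> * (\<integral>\<^sup>+y. g (x(i := \<rho> * y + v i)) \<partial>lborel)"
      by (simp add: add.commute)
  qed
  also have "\<dots> = ennreal \<rho> * (\<integral>\<^sup>+x. (\<integral>\<^sup>+y. g (x(i := \<rho> * y + v i)) \<partial>lborel) \<partial>PiM I (\<lambda>_. lborel))"
    by (rule nn_integral_cmult) measurable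
  also have "(\<integral>\<^sup>+x. (\<integral>\<^sup>+y. g (x(i := \<rho> * y + v i)) \<partial>lborel) \<partial>PiM I (\<lambda>_. lborel))
    = ennreal (\<rho> ^ card I) * (\<integral>\<^sup>+x. (\<integral>\<^sup>+y. g ((\<lambda>i\<in>I. \<rho> * x i + v i)(i := \<rho> * y + v i)) \<partial>lborel) \<partial>PiM I (\<lambda>_. lborel))"
    by (rule insert.IH[OF insert.prems(1)]) measurable
  also have "(\<integral>\<^sup>+x. (\<integral>\<^sup>+y. g ((\<lambda>i\<in>I. \<rho> * x i + v i)(i := \<rho> * y + v i)) \<partial>lborel) \<partial>PiM I (\<lambda>_. lborel))
    = (\<integral>\<^sup>+x. (\<integral>\<^sup>+y. g (\<lambda>k\<in>insert i I. \<rho> * (x(i := y)) k + v k) \<partial>lborel) \<partial>PiM I (\<lambda>_. lborel))"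
    using insert.hyps(2) by (intro nn_integral_cong arg_cong[where f = g]) (auto simp: restrict_def fun_eq_iff)
  also have "\<dots> = (\<integral>\<^sup>+x. g (\<lambda>k\<in>insert i I. \<rho> * x k + v k) \<partial>PiM (insert i I) (\<lambda>_. lborel))"
    by (rule lborel_prod.product_nn_integral_insert[OF insert.hyps(1,2), symmetric]) measurable
  finally have *: "(\<integral>\<^sup>+x. g x \<partial>PiM (insert i I) (\<lambda>_. lborel))
    = ennreal \<rho> * (ennreal (\<rho> ^ card I) * (\<integral>\<^sup>+x. g (\<lambda>k\<in>insert i I. \<rho> * x k + v k) \<partial>PiM (insert i I) (\<lambda>_. lborel)))" .
  have "ennreal (\<rho> ^ card (insert i I)) = ennreal \<rho> * ennreal (\<rho> ^ card I)"
    using insert.hyps insert.prems(1) by (simp add: ennreal_mult)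
  then show ?case by (simp only: * mult.assoc)
qed

lemma measurable_vec_lambda [measurable (raw)]:
  fixes f :: "'m::finite \<Rightarrow> 'b \<Rightarrow> real"
  assumes "\<And>k. f k \<in> borel_measurable M"
  shows "(\<lambda>x. (\<chi> k. f k x) :: real ^ 'm) \<in> borel_measurable M"
  by (rule borel_measurable_euclidean_space[THEN iffD2])
     (use assms in \<open>auto simp: Basis_vec_def inner_axis\<close>)

text \<open>The index map \<open>\<tau>\<close> is the identity where a single coordinate is split
  off, and an enumeration by natural numbers where the vector is compared with coordinates in an
  orthonormal family.\<close>

lemma lborel_vec_eq_distr_PiM:
  fixes \<tau> :: "'m::finite \<Rightarrow> 'i"
  assumes \<tau>: "bij_betw \<tau> UNIV I"
  shows "(lborel :: (real ^ 'm) measure) = distr (PiM I (\<lambda>_. lborel)) borel (\<lambda>x. \<chi> k. x (\<tau> k))"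
proof (rule lborel_eqI)
  have I: "finite I" "\<And>k. \<tau> k \<in> I" "inj \<tau>" "range \<tau> = I"
    using \<tau> by (auto simp: bij_betw_def)
  define \<sigma> where "\<sigma> = inv \<tau>"
  have \<sigma>: "\<sigma> (\<tau> k) = k" for k unfolding \<sigma>_def using I(3) by simp
  fix l u :: "real ^ 'm" assume "\<And>b. b \<in> Basis \<Longrightarrow> l \<bullet> b \<le> u \<bullet> b"
  from this[of "axis _ 1"] have le: "l $ k \<le> u $ k" for k by (simp add: inner_axis)
  have [measurable]: "(\<lambda>x. (\<chi> k. x (\<tau> k)) :: real ^ 'm) \<in> borel_measurable (PiM I (\<lambda>_. lborel))"
    using I(2) by measurable
  have "emeasure (distr (PiM I (\<lambda>_. lborel)) borel (\<lambda>x. \<chi> k. x (\<tau> k))) (box l u)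
    = emeasure (PiM I (\<lambda>_. lborel)) (PiE I (\<lambda>i. {l $ \<sigma> i <..< u $ \<sigma> i}))"
    using I \<sigma> by (subst emeasure_distr)
      (auto simp: mem_box_cart space_PiM PiE_def Pi_iff intro!: arg_cong[where f = "emeasure _"])
  also have "\<dots> = (\<Prod>i\<in>I. ennreal (u $ \<sigma> i - l $ \<sigma> i))"
    using I(1) le by (subst lborel_prod.emeasure_PiM) auto
  also have "\<dots> = (\<Prod>k\<in>UNIV. ennreal (u $ k - l $ k))"
    unfolding I(4)[symmetric] by (subst prod.reindex[OF I(3)]) (simp add: \<sigma>)
  also have "\<dots> = ennreal (\<Prod>k\<in>UNIV. u $ k - l $ k)"
    using le by (simp add: prod_ennreal)
  also have "(\<Prod>k\<in>UNIV. u $ k - l $ k) = (\<Prod>b\<in>Basis. (u - l) \<bullet> b)"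
  proof -
    have "(\<Prod>b\<in>range (\<lambda>k. axis k 1). (u - l) \<bullet> b) = (\<Prod>k\<in>UNIV. u $ k - l $ k)"
      by (subst prod.reindex) (auto simp: inj_def axis_eq_axis inner_axis)
    moreover have "range (\<lambda>k. axis k 1) = (Basis :: (real ^ 'm) set)" by (auto simp: Basis_vec_def)
    ultimately show ?thesis by (simp only:)
  qed
  finally show "emeasure (distr (PiM I (\<lambda>_. lborel)) borel (\<lambda>x. \<chi> k. x (\<tau> k))) (box l u)
    = ennreal (\<Prod>b\<in>Basis. (u - l) \<bullet> b)" .
qed simp

lemma orthonormal_familyD:
  "orthonormal_family k b \<Longrightarrow> i < k \<Longrightarrow> j < k \<Longrightarrow> b i \<bullet> b j = (if i = j then 1 else 0)"
  by (auto simp: orthonormal_family_def)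

lemma orthonormal_family_inner:
  assumes "orthonormal_family k b"
  shows "i < k \<Longrightarrow> (\<Sum>j<k. c j *\<^sub>R b j) \<bullet> b i = c i"
    and "(\<Sum>j<k. c j *\<^sub>R b j) \<bullet> (\<Sum>j<k. c j *\<^sub>R b j) = (\<Sum>j<k. (c j)\<^sup>2)"
proof -
  show 1: "(\<Sum>j<k. c j *\<^sub>R b j) \<bullet> b i = c i" if "i < k" for i
  proof -
    have "(\<Sum>j<k. c j *\<^sub>R b j) \<bullet> b i = (\<Sum>j<k. c j * (if j = i then 1 else 0))"
      unfolding inner_sum_left using that by (intro sum.cong) (auto simp: orthonormal_familyD[OF assms])
    also have "\<dots> = (\<Sum>j<k. if j = i then c j else 0)" by (intro sum.cong) auto
    finally show ?thesis using that by simp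
  qed
  show "(\<Sum>j<k. c j *\<^sub>R b j) \<bullet> (\<Sum>j<k. c j *\<^sub>R b j) = (\<Sum>j<k. (c j)\<^sup>2)"
    by (simp add: inner_sum_right[of _ _ "{..<k}"] 1 power2_eq_square)
qed

text \<open>Orthonormal vectors are independent, so \<open>k\<close> of them span a subspace of
  dimension at most \<open>k\<close> that contains them; the coefficients are then the inner
  products.\<close>

lemma orthonormal_family_expand:
  fixes b :: "nat \<Rightarrow> 'a::euclidean_space"
  assumes b: "orthonormal_family k b" and V: "subspace V" "\<And>i. i < k \<Longrightarrow> b i \<in> V" "dim V \<le> k"
    and x: "x \<in> V"
  shows "(\<Sum>i<k. (x \<bullet> b i) *\<^sub>R b i) = x"
proof -
  have inj: "inj_on b {..<k}"
    by (rule inj_onI) (metis b lessThan_iff orthonormal_familyD zero_neq_one)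
  have "pairwise orthogonal (b ` {..<k})"
    using orthonormal_familyD[OF b] by (auto simp: pairwise_def orthogonal_def)
  moreover have "0 \<notin> b ` {..<k}"
  proof
    assume "0 \<in> b ` {..<k}"
    then obtain i where "i < k" "b i = 0" by auto
    then show False using orthonormal_familyD[OF b, of i i] by simp
  qed
  ultimately have indep: "independent (b ` {..<k})" by (rule pairwise_orthogonal_independent)
  have sub: "span (b ` {..<k}) \<subseteq> V" using V by (intro span_minimal) auto
  have card: "dim (span (b ` {..<k})) = k"
    using indep inj by (simp add: dim_eq_card_independent card_image)
  have "span (b ` {..<k}) = V"
    using sub V(1,3) card by (intro subspace_dim_equal) auto
  then have "x \<in> span (b ` {..<k})" using x by simp
  then obtain c where "x = (\<Sum>v\<in>b ` {..<k}. c v *\<^sub>R v)" by (auto simp: span_finite)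
  then have "x = (\<Sum>i<k. c (b i) *\<^sub>R b i)" by (simp add: sum.reindex[OF inj])
  then show "(\<Sum>i<k. (x \<bullet> b i) *\<^sub>R b i) = x"
    using orthonormal_family_inner(1)[OF b, of _ "\<lambda>i. c (b i)"] by simp
qed

text \<open>
  Lebesgue measure and the product measure in the orthonormal coordinates are both translation
  invariant, hence proportional by Fubini; they agree on the unit ball.
\<close>

lemma nn_integral_orthonormal_coordinates:
  fixes B :: "nat \<Rightarrow> real ^ 'm" and g :: "real ^ 'm \<Rightarrow> ennreal"
  assumes B: "orthonormal_family N B" and N: "CARD('m) = N" and [measurable]: "g \<in> borel_measurable borel"
  shows "(\<integral>\<^sup>+x. g x \<partial>lborel) = (\<integral>\<^sup>+c. g (\<Sum>i<N. c i *\<^sub>R B i) \<partial>PiM {..<N} (\<lambda>_. lborel))"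
proof -
  let ?M = "PiM {..<N} (\<lambda>_. lborel) :: (nat \<Rightarrow> real) measure"
  define S where "S c = (\<Sum>i<N. c i *\<^sub>R B i)" for c
  have [measurable]: "S \<in> borel_measurable ?M" unfolding S_def by measurable
  have expand: "(\<Sum>i<N. (x \<bullet> B i) *\<^sub>R B i) = x" for x
    using N by (intro orthonormal_family_expand[OF B, of UNIV]) auto
  have shift: "(\<integral>\<^sup>+c. h (S c) \<partial>?M) = (\<integral>\<^sup>+c. h (S c + x) \<partial>?M)"
    if [measurable]: "h \<in> borel_measurable borel" for x and h :: "real ^ 'm \<Rightarrow> ennreal"
  proof -
    have "(\<integral>\<^sup>+c. h (S c) \<partial>?M) = (\<integral>\<^sup>+c. h (S (\<lambda>i\<in>{..<N}. 1 * c i + x \<bullet> B i)) \<partial>?M)"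
      using nn_integral_PiM_affine[of "{..<N}" 1 "\<lambda>c. h (S c)" "\<lambda>i. x \<bullet> B i"] by simp
    moreover have "S (\<lambda>i\<in>{..<N}. 1 * c i + x \<bullet> B i) = S c + x" for c
      unfolding S_def using expand[of x] by (simp add: scaleR_add_left sum.distrib)
    ultimately show ?thesis by simp
  qed
  define f where "f = (indicator (ball 0 1) :: real ^ 'm \<Rightarrow> ennreal)"
  have [measurable]: "f \<in> borel_measurable borel" unfolding f_def by (intro borel_measurable_indicator) simp
  obtain \<tau> :: "'m \<Rightarrow> nat" where \<tau>: "bij_betw \<tau> UNIV {..<N}"
    using N ex_bij_betw_finite_nat[of "UNIV :: 'm set"] by (auto simp: atLeast0LessThan)
  \<comment> \<open>In both systems the norm is the root of the sum of squared coordinates, so the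
    unit ball has the same mass in both.\<close>
  have "(\<integral>\<^sup>+x. f x \<partial>lborel) = (\<integral>\<^sup>+c. f (\<chi> k. c (\<tau> k)) \<partial>?M)"
    using bij_betwE[OF \<tau>] by (subst lborel_vec_eq_distr_PiM[OF \<tau>]) (simp add: nn_integral_distr)
  also have "\<dots> = (\<integral>\<^sup>+c. f (S c) \<partial>?M)"
  proof (rule nn_integral_cong)
    fix c :: "nat \<Rightarrow> real"
    have "norm ((\<chi> k. c (\<tau> k)) :: real ^ 'm) = sqrt (\<Sum>k\<in>UNIV. (c (\<tau> k))\<^sup>2)"
      by (simp add: norm_vec_def L2_set_def)
    moreover have "(\<Sum>k\<in>UNIV. (c (\<tau> k))\<^sup>2) = (\<Sum>i<N. (c i)\<^sup>2)"
      by (rule sum.reindex_bij_betw[OF \<tau>])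
    moreover have "norm (S c) = sqrt (\<Sum>i<N. (c i)\<^sup>2)"
      unfolding norm_eq_sqrt_inner S_def by (simp add: orthonormal_family_inner(2)[OF B])
    ultimately have "norm ((\<chi> k. c (\<tau> k)) :: real ^ 'm) = norm (S c)" by simp
    then show "f (\<chi> k. c (\<tau> k)) = f (S c)" by (simp add: f_def indicator_def)
  qed
  finally have ball: "(\<integral>\<^sup>+x. f x \<partial>lborel) = (\<integral>\<^sup>+c. f (S c) \<partial>?M)" .
  \<comment> \<open>The uniqueness argument for Haar measure: translating first in one measure and
    then in the other exchanges the measures against which \<open>f\<close> and \<open>g\<close> are
    integrated.\<close>
  have "(\<integral>\<^sup>+x. f x \<partial>lborel) * (\<integral>\<^sup>+c. g (S c) \<partial>?M) = (\<integral>\<^sup>+x. f x * (\<integral>\<^sup>+c. g (S c + x) \<partial>?M) \<partial>lborel)"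
    by (simp add: nn_integral_multc flip: shift)
  also have "\<dots> = (\<integral>\<^sup>+x. (\<integral>\<^sup>+c. f x * g (S c + x) \<partial>?M) \<partial>lborel)"
    by (simp add: nn_integral_cmult)
  also have "\<dots> = (\<integral>\<^sup>+c. (\<integral>\<^sup>+x. f x * g (S c + x) \<partial>lborel) \<partial>?M)"
    by (rule pair_sigma_finite.Fubini')
       (simp_all add: pair_sigma_finite_def lborel_prod.sigma_finite lborel.sigma_finite_measure_axioms)
  also have "\<dots> = (\<integral>\<^sup>+c. (\<integral>\<^sup>+x. f (x - S c) * g x \<partial>lborel) \<partial>?M)"
  proof (rule nn_integral_cong)
    fix c
    have "(\<integral>\<^sup>+x. f (x - S c) * g x \<partial>lborel) = (\<integral>\<^sup>+x. f (S c + x - S c) * g (S c + x) \<partial>lborel)"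
      by (subst lborel_distr_plus[of "S c", symmetric], subst nn_integral_distr) simp_all
    then show "(\<integral>\<^sup>+x. f x * g (S c + x) \<partial>lborel) = (\<integral>\<^sup>+x. f (x - S c) * g x \<partial>lborel)" by simp
  qed
  also have "\<dots> = (\<integral>\<^sup>+x. (\<integral>\<^sup>+c. f (x - S c) * g x \<partial>?M) \<partial>lborel)"
    by (rule pair_sigma_finite.Fubini'[symmetric])
       (simp_all add: pair_sigma_finite_def lborel_prod.sigma_finite lborel.sigma_finite_measure_axioms)
  \<comment> \<open>The ball is symmetric about the origin, so \<open>f (x - S c)\<close> equals
    \<open>f (S c - x)\<close>.\<close>
  also have "\<dots> = (\<integral>\<^sup>+x. (\<integral>\<^sup>+c. f (S c + - x) \<partial>?M) * g x \<partial>lborel)"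
    by (simp add: nn_integral_multc f_def indicator_def dist_norm norm_minus_commute)
  also have "\<dots> = (\<integral>\<^sup>+c. f (S c) \<partial>?M) * (\<integral>\<^sup>+x. g x \<partial>lborel)"
    by (subst shift[symmetric]) (simp_all add: nn_integral_cmult)
  finally have eq: "(\<integral>\<^sup>+x. f x \<partial>lborel) * (\<integral>\<^sup>+c. g (S c) \<partial>?M) = (\<integral>\<^sup>+x. f x \<partial>lborel) * (\<integral>\<^sup>+x. g x \<partial>lborel)"
    by (simp flip: ball)
  have "(\<integral>\<^sup>+x. f x \<partial>lborel) = emeasure lborel (ball (0 :: real ^ 'm) 1)"
    by (simp add: f_def)
  moreover have "emeasure lborel (ball (0 :: real ^ 'm) 1) \<noteq> \<infinity>"
    using emeasure_lborel_ball_finite[of "0 :: real ^ 'm" 1] by simp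
  moreover have "emeasure lborel (ball (0 :: real ^ 'm) 1) \<noteq> 0"
    using open_not_negligible[of "ball (0 :: real ^ 'm) 1"]
    by (auto simp: negligible_iff_null_sets null_sets_def emeasure_completion)
  ultimately show ?thesis using eq by (simp add: ennreal_mult_cancel_left S_def)
qed

subsection \<open>The section volume as a density\<close>

lemma inner_one_vec: "(x :: real ^ 'm) \<bullet> 1 = (\<Sum>k\<in>UNIV. x $ k)"
  by (simp add: inner_vec_def)

lemma dim_perp_one_perp:
  fixes a :: "real ^ 'm"
  assumes N: "CARD('m) = Suc (Suc k)" and a1: "a \<bullet> 1 = 0" and aa: "a \<bullet> a = 1"
  shows "dim {x. x \<bullet> a = 0 \<and> x \<bullet> 1 = 0} = k"
proof -
  have "(1 :: real ^ 'm) \<bullet> 1 \<noteq> 0" using N by (simp add: inner_one_vec)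
  then have ne: "a \<noteq> (1 :: real ^ 'm)" and nz: "a \<noteq> 0" "(1 :: real ^ 'm) \<noteq> 0" using a1 aa by auto
  have ind: "independent {a, 1}"
    using ne nz a1 by (intro pairwise_orthogonal_independent) (auto simp: pairwise_def orthogonal_def inner_commute)
  have "dim {y \<in> UNIV. \<forall>x\<in>span {a, 1}. orthogonal x y} + dim (span {a, 1}) = dim (UNIV :: (real ^ 'm) set)"
    by (rule dim_subspace_orthogonal_to_vectors) auto
  also have "{y \<in> UNIV. \<forall>x\<in>span {a, 1}. orthogonal x y} = {x. x \<bullet> a = 0 \<and> x \<bullet> 1 = 0}"
  proof (intro equalityI subsetI)
    fix y assume "y \<in> {y \<in> UNIV. \<forall>x\<in>span {a, 1}. orthogonal x y}"
    then show "y \<in> {x. x \<bullet> a = 0 \<and> x \<bullet> 1 = 0}"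
      by (auto simp: orthogonal_def inner_commute span_base)
  next
    fix y assume "y \<in> {x. x \<bullet> a = 0 \<and> x \<bullet> 1 = 0}"
    then have "orthogonal y x" if "x \<in> span {a, 1}" for x
      using that by (intro orthogonal_to_span[of x "{a, 1}"]) (auto simp: orthogonal_def)
    then show "y \<in> {y \<in> UNIV. \<forall>x\<in>span {a, 1}. orthogonal x y}"
      by (simp add: orthogonal_commute)
  qed
  finally show ?thesis using ind ne N by (simp add: dim_eq_card_independent)
qed

lemma subspace_perp_one_perp: "subspace {x :: real ^ 'm. x \<bullet> a = 0 \<and> x \<bullet> 1 = 0}"
  by (auto simp: subspace_def inner_add_left)

lemma flat_point_inner:
  "flat_point k p b c \<bullet> x = p \<bullet> x + (\<Sum>i<k. c i * (b i \<bullet> x))"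
  by (simp add: flat_point_def inner_add_left inner_sum_left)

text \<open>\<open>vol\<close> evaluates an arbitrarily chosen frame, of which only orthonormality
  and a containment are known. The barycentre pins it down: the section contains a neighbourhood of
  it within its flat, so the span of the frame contains \<open>D\<close>, and equality follows by
  counting dimensions. Every point of the frame then satisfies both linear equations, and only the
  sign conditions remain.\<close>

lemma simplex_section_frame:
  fixes a :: "real ^ 'm"
  assumes N: "CARD('m) = Suc (Suc k)" and a1: "a \<bullet> 1 = 0" and aa: "a \<bullet> a = 1"
  obtains p b where "orthonormal_family k b" "\<And>i. i < k \<Longrightarrow> b i \<bullet> a = 0" "\<And>i. i < k \<Longrightarrow> b i \<bullet> 1 = 0"
    "p \<bullet> a = 0" "p \<bullet> 1 = 1"
    "vol k (regular_simplex \<inter> perp a) = emeasure (PiM {..<k} (\<lambda>_. lborel))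
       {c \<in> space (PiM {..<k} (\<lambda>_. lborel)). \<forall>l. 0 \<le> flat_point k p b c $ l}"
proof -
  define S where "S = regular_simplex \<inter> perp a"
  define D where "D = {x. x \<bullet> a = 0 \<and> x \<bullet> 1 = 0}"
  have D: "subspace D" "dim D = k"
    unfolding D_def using subspace_perp_one_perp dim_perp_one_perp[OF N a1 aa] by auto
  define \<beta> where "\<beta> = (1 / real CARD('m)) *\<^sub>R (1 :: real ^ 'm)"
  have \<beta>: "\<beta> \<bullet> a = 0" "\<beta> \<bullet> 1 = 1" "\<And>l. \<beta> $ l = 1 / real CARD('m)"
    unfolding \<beta>_def using a1 by (auto simp: inner_one_vec inner_commute)
  have S_iff: "x \<in> S \<longleftrightarrow> (\<forall>l. 0 \<le> x $ l) \<and> x \<bullet> 1 = 1 \<and> x \<bullet> a = 0" for x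
    by (auto simp: S_def regular_simplex_def perp_def inner_one_vec)
  have \<beta>S: "\<beta> \<in> S" using \<beta> by (simp add: S_iff)
  have "\<exists>F. is_frame_for k S F"
  proof -
    obtain B where B: "B \<subseteq> D" "pairwise orthogonal B" "\<And>x. x \<in> B \<Longrightarrow> norm x = 1"
        "independent B" "card B = dim D" "span B = D"
      using orthonormal_basis_subspace[OF D(1)] by blast
    have "finite B" using B(4) by (rule finiteI_independent)
    then obtain b where b: "bij_betw b {..<k} B"
      using ex_bij_betw_nat_finite[of B] B(5) D(2) by (auto simp: atLeast0LessThan)
    have on: "orthonormal_family k b"
      unfolding orthonormal_family_def
    proof (intro allI impI)
      fix i j assume ij: "i < k" "j < k"
      then have bB: "b i \<in> B" "b j \<in> B" using bij_betwE[OF b] by auto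
      show "b i \<bullet> b j = (if i = j then 1 else 0)"
      proof (cases "i = j")
        case True
        then show ?thesis using B(3)[OF bB(1)] by (simp add: norm_eq_1)
      next
        case False
        then have "b i \<noteq> b j" using b ij by (auto simp: bij_betw_def inj_on_def)
        then show ?thesis using B(2) bB False by (auto simp: pairwise_def orthogonal_def)
      qed
    qed
    have "S \<subseteq> range (flat_point k \<beta> b)"
    proof
      fix x assume "x \<in> S"
      then have "x - \<beta> \<in> D" using \<beta> by (auto simp: S_iff D_def inner_diff_left)
      then have "(\<Sum>i<k. ((x - \<beta>) \<bullet> b i) *\<^sub>R b i) = x - \<beta>"
        using B(1) bij_betwE[OF b] D by (intro orthonormal_family_expand[OF on D(1)]) auto
      then have "x = flat_point k \<beta> b (\<lambda>i. (x - \<beta>) \<bullet> b i)" by (simp add: flat_point_def)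
      then show "x \<in> range (flat_point k \<beta> b)" by blast
    qed
    with on show ?thesis unfolding is_frame_for_def by (intro exI[of _ "(\<beta>, b)"]) simp
  qed
  then have fr: "is_frame_for k S (SOME F. is_frame_for k S F)" by (rule someI_ex)
  obtain p b where pb: "(SOME F. is_frame_for k S F) = (p, b)" by fastforce
  have on: "orthonormal_family k b" and sub: "S \<subseteq> range (flat_point k p b)"
    using fr[unfolded pb] by (auto simp: is_frame_for_def)
  have bB: "dim (span (b ` {..<k})) \<le> k"
    using card_image_le[of "{..<k}" b] dim_le_card'[of "b ` {..<k}"] by (simp add: order_trans)
  have DS: "D \<subseteq> span (b ` {..<k})"
  proof
    fix d assume d: "d \<in> D"
    \<comment> \<open>A small displacement of the barycentre in a direction of the section stays in the simplex.\<close>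
    define \<epsilon> where "\<epsilon> = 1 / (real CARD('m) * (1 + norm d))"
    have \<epsilon>: "\<epsilon> > 0" unfolding \<epsilon>_def by (simp add: add_pos_nonneg)
    have "\<beta> + \<epsilon> *\<^sub>R d \<in> S"
      unfolding S_iff
    proof (intro conjI allI)
      fix l
      have "\<epsilon> * \<bar>d $ l\<bar> \<le> \<epsilon> * (1 + norm d)"
        using \<epsilon> component_le_norm_cart[of d l] by (intro mult_left_mono) auto
      also have "\<dots> = 1 / real CARD('m)" unfolding \<epsilon>_def by (simp add: add_nonneg_eq_0_iff)
      finally have "- (1 / real CARD('m)) \<le> \<epsilon> * d $ l"
        using \<epsilon> by (smt (verit) mult_minus_right mult_left_mono)
      then show "0 \<le> (\<beta> + \<epsilon> *\<^sub>R d) $ l" by (simp add: \<beta>)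
    qed (use d \<beta> in \<open>auto simp: D_def inner_add_left\<close>)
    with sub \<beta>S obtain c c' where c: "\<beta> + \<epsilon> *\<^sub>R d = flat_point k p b c" "\<beta> = flat_point k p b c'" by blast
    then have "\<epsilon> *\<^sub>R d = flat_point k p b c - flat_point k p b c'" by (metis add_diff_cancel_left')
    also have "\<dots> = (\<Sum>i<k. c i *\<^sub>R b i) - (\<Sum>i<k. c' i *\<^sub>R b i)" by (simp add: flat_point_def)
    also have "\<dots> \<in> span (b ` {..<k})"
      by (intro span_diff span_sum span_scale span_base) auto
    finally have "(1 / \<epsilon>) *\<^sub>R (\<epsilon> *\<^sub>R d) \<in> span (b ` {..<k})" by (rule span_scale)
    then show "d \<in> span (b ` {..<k})" using \<epsilon> by simp
  qed
  have "D = span (b ` {..<k})"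
    using DS D bB by (intro subspace_dim_equal) auto
  then have bD: "b i \<in> D" if "i < k" for i using that by (auto intro: span_base)
  obtain c where c: "\<beta> = flat_point k p b c" using sub \<beta>S by blast
  have p: "p \<bullet> a = 0" "p \<bullet> 1 = 1"
    using \<beta>(1,2) bD unfolding c flat_point_inner by (auto simp: D_def)
  show thesis
  proof (rule that[OF on _ _ p])
    show "i < k \<Longrightarrow> b i \<bullet> a = 0" "i < k \<Longrightarrow> b i \<bullet> 1 = 0" for i using bD by (auto simp: D_def)
    have "flat_point k p b c \<bullet> a = 0" "flat_point k p b c \<bullet> 1 = 1" for c
      unfolding flat_point_inner using p bD by (auto simp: D_def)
    then show "vol k (regular_simplex \<inter> perp a) = emeasure (PiM {..<k} (\<lambda>_. lborel))
       {c \<in> space (PiM {..<k} (\<lambda>_. lborel)). \<forall>l. 0 \<le> flat_point k p b c $ l}"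
      unfolding S_def[symmetric] vol_def pb Let_def by (simp add: S_iff)
  qed
qed

section \<open>One weight integrated in two coordinate systems\<close>

lemma nn_integral_indicator_affine:
  fixes c :: real assumes "c \<noteq> 0"
  shows "(\<integral>\<^sup>+y. indicator {0..1} (t + c * y) \<partial>lborel) = ennreal (1 / \<bar>c\<bar>)"
proof -
  have "ennreal \<bar>c\<bar> * (\<integral>\<^sup>+y. indicator {0..1} (t + c * y) \<partial>lborel) = 1"
    using nn_integral_real_affine[of "indicator {0..1}" c t] assms by simp
  then have "ennreal (1 / \<bar>c\<bar>) * (ennreal \<bar>c\<bar> * (\<integral>\<^sup>+y. indicator {0..1} (t + c * y) \<partial>lborel)) = ennreal (1 / \<bar>c\<bar>)"
    by simp
  moreover have "ennreal (1 / \<bar>c\<bar>) * ennreal \<bar>c\<bar> = 1" using assms by (simp flip: ennreal_mult')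
  ultimately show ?thesis by (simp flip: mult.assoc)
qed

definition orthant_weight :: "real ^ 'm \<Rightarrow> ennreal" where
  "orthant_weight x = (\<Prod>k\<in>UNIV. expo (x $ k))"

lemma measurable_orthant_weight [measurable]: "orthant_weight \<in> borel_measurable borel"
  unfolding orthant_weight_def by measurable

text \<open>Within the orthant the weight depends only on the coordinate sum, hence is constant on
  slices parallel to the simplex. This is what permits radial integration.\<close>

lemma orthant_weight_eq:
  "orthant_weight x = ennreal (exp (- (x \<bullet> 1))) * (if \<forall>k. 0 \<le> x $ k then 1 else 0)"
proof (cases "\<forall>k. 0 \<le> x $ k")
  case True
  then have "orthant_weight x = (\<Prod>k\<in>UNIV. ennreal (exp (- (x $ k))))"
    by (simp add: orthant_weight_def expo_def)
  also have "\<dots> = ennreal (exp (- (x \<bullet> 1)))"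
    by (simp add: prod_ennreal inner_one_vec exp_sum sum_negf[symmetric])
  finally show ?thesis using True by simp
next
  case False
  then obtain k where "x $ k < 0" by (auto simp: not_le)
  then have "orthant_weight x = 0"
    unfolding orthant_weight_def by (intro prod_zero) (auto simp: expo_def intro!: exI[of _ k])
  then show ?thesis using False by simp
qed

text \<open>
  The slab over the unit interval in direction \<open>a\<close>, projected obliquely onto \<open>a\<^sup>\<bottom>\<close> along a
  coordinate axis. The weight below is integrated twice: along that axis, and in an orthonormal
  basis containing \<open>a\<close>.
\<close>

definition slab_weight :: "real ^ 'm \<Rightarrow> 'm \<Rightarrow> real ^ 'm \<Rightarrow> ennreal" where
  "slab_weight a j x = indicator {0..1} (x \<bullet> a) * orthant_weight (x - ((x \<bullet> a) / a $ j) *\<^sub>R axis j 1)"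

lemma measurable_slab_weight [measurable]: "slab_weight a j \<in> borel_measurable borel"
  unfolding slab_weight_def by measurable

text \<open>The projection along the \<open>j\<close>-th axis forgets the coordinate
  \<open>j\<close>, which then enters only through the indicator and contributes
  \<open>1 / \<bar>a $ j\<bar>\<close>. The projected point has \<open>j\<close>-th coordinate
  \<open>(0 - ?s) / a $ j\<close>, where \<open>?s\<close> sums \<open>a $ i * x i\<close> over the
  other indices. Together these make up \<open>expo_density (a $ j)\<close>.\<close>

lemma nn_integral_slab_weight_coordinates:
  fixes a :: "real ^ 'm"
  assumes aj: "a $ j \<noteq> 0"
  shows "(\<integral>\<^sup>+x. slab_weight a j x \<partial>lborel) = sum_density (($) a) j (UNIV - {j}) 0"
proof -
  let ?I = "UNIV - {j}"
  have U: "insert j ?I = UNIV" by auto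
  have "(\<integral>\<^sup>+x. slab_weight a j x \<partial>lborel)
    = (\<integral>\<^sup>+x. slab_weight a j (\<chi> k. x k) \<partial>PiM UNIV (\<lambda>_. lborel))"
    by (subst lborel_vec_eq_distr_PiM[of id UNIV]) (simp_all add: nn_integral_distr)
  also have "\<dots> = (\<integral>\<^sup>+x. (\<integral>\<^sup>+y. slab_weight a j (\<chi> k. (x(j := y)) k) \<partial>lborel) \<partial>PiM ?I (\<lambda>_. lborel))"
    using lborel_prod.product_nn_integral_insert[of ?I j "\<lambda>x. slab_weight a j (\<chi> k. x k)"] by (simp add: U)
  also have "\<dots> = (\<integral>\<^sup>+x. (\<Prod>i\<in>?I. expo (x i)) * expo_density (a $ j) (0 - (\<Sum>i\<in>?I. a $ i * x i)) \<partial>PiM ?I (\<lambda>_. lborel))"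
  proof (rule nn_integral_cong)
    fix x :: "'m \<Rightarrow> real"
    let ?s = "\<Sum>i\<in>?I. a $ i * x i"
    have "slab_weight a j (\<chi> k. (x(j := y)) k)
      = indicator {0..1} (?s + a $ j * y) * ((\<Prod>i\<in>?I. expo (x i)) * expo ((0 - ?s) / a $ j))" for y
    proof -
      let ?x = "(\<chi> k. (x(j := y)) k) :: real ^ 'm"
      have ip: "?x \<bullet> a = ?s + a $ j * y"
        by (simp add: inner_vec_def sum.remove[of UNIV j] mult.commute add.commute)
      have "orthant_weight (?x - ((?x \<bullet> a) / a $ j) *\<^sub>R axis j 1)
        = expo (y - (?s + a $ j * y) / a $ j) * (\<Prod>i\<in>?I. expo (x i))"
        unfolding orthant_weight_def ip
        by (subst prod.remove[of UNIV j]) (auto simp: axis_def intro!: prod.cong)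
      also have "y - (?s + a $ j * y) / a $ j = (0 - ?s) / a $ j"
        using aj by (simp add: field_simps)
      finally have *: "orthant_weight (?x - ((?x \<bullet> a) / a $ j) *\<^sub>R axis j 1)
        = expo ((0 - ?s) / a $ j) * (\<Prod>i\<in>?I. expo (x i))" .
      show ?thesis unfolding slab_weight_def * unfolding ip by (simp only: mult_ac)
    qed
    then have "(\<integral>\<^sup>+y. slab_weight a j (\<chi> k. (x(j := y)) k) \<partial>lborel)
      = ennreal (1 / \<bar>a $ j\<bar>) * ((\<Prod>i\<in>?I. expo (x i)) * expo ((0 - ?s) / a $ j))"
      using aj by (simp add: nn_integral_multc nn_integral_indicator_affine)
    then show "(\<integral>\<^sup>+y. slab_weight a j (\<chi> k. (x(j := y)) k) \<partial>lborel)
      = (\<Prod>i\<in>?I. expo (x i)) * expo_density (a $ j) (0 - ?s)"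
      by (simp add: expo_density_def mult_ac)
  qed
  finally show ?thesis by (simp add: sum_density_def)
qed

text \<open>The basis consists of the frame, the normalised all-ones vector and \<open>a\<close>.
  The slab has width \<open>1\<close>; the coordinate sum as variable in the all-ones direction
  costs the factor \<open>1 / sqrt (k + 2)\<close>; and the slice with sum \<open>\<rho>\<close> is
  the section scaled by \<open>\<rho>\<close>, so that integrating
  \<open>\<rho> ^ k * exp (- \<rho>)\<close> gives \<open>fact k\<close>.\<close>

lemma nn_integral_slab_weight_frame:
  fixes a :: "real ^ 'm"
  assumes N: "CARD('m) = Suc (Suc k)" and b: "orthonormal_family k b"
    and ba: "\<And>i. i < k \<Longrightarrow> b i \<bullet> a = 0" and b1: "\<And>i. i < k \<Longrightarrow> b i \<bullet> 1 = 0"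
    and pa: "p \<bullet> a = 0" and p1: "p \<bullet> 1 = 1"
    and a1: "a \<bullet> 1 = 0" and aa: "a \<bullet> a = 1" and aj: "a $ j \<noteq> 0"
  shows "(\<integral>\<^sup>+x. slab_weight a j x \<partial>lborel) = ennreal (fact k / sqrt (k + 2)) *
    emeasure (PiM {..<k} (\<lambda>_. lborel)) {c \<in> space (PiM {..<k} (\<lambda>_. lborel)). \<forall>l. 0 \<le> flat_point k p b c $ l}"
proof -
  let ?M = "\<lambda>k. PiM {..<k} (\<lambda>_. lborel) :: (nat \<Rightarrow> real) measure"
  define r where "r = sqrt (real k + 2)"
  have r: "r > 0" "r * r = real k + 2" unfolding r_def by auto
  have one: "(1 :: real ^ 'm) \<bullet> 1 = r * r" using N r by (simp add: inner_one_vec)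
  define B where "B i = (if i < k then b i else if i = k then (1 / r) *\<^sub>R 1 else a)" for i
  have Bs: "i < k \<Longrightarrow> B i = b i" "B k = (1 / r) *\<^sub>R 1" "B (Suc k) = a" for i by (auto simp: B_def)
  have comm: "1 \<bullet> a = 0" "\<And>i. i < k \<Longrightarrow> a \<bullet> b i = 0" "\<And>i. i < k \<Longrightarrow> 1 \<bullet> b i = 0"
    using a1 ba b1 by (simp_all add: inner_commute)
  have oB: "orthonormal_family (Suc (Suc k)) B"
    unfolding orthonormal_family_def
    using r one a1 aa ba b1 comm orthonormal_familyD[OF b]
    by (auto simp: B_def less_Suc_eq)
  have expand: "(\<Sum>i<Suc (Suc k). (x \<bullet> B i) *\<^sub>R B i) = x" for x
    using N by (intro orthonormal_family_expand[OF oB, of UNIV]) auto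
  have sumB: "(\<Sum>i<k. c i *\<^sub>R B i) = (\<Sum>i<k. c i *\<^sub>R b i)" for c
    by (intro sum.cong) (auto simp: Bs)
  define T where "T c = (\<Sum>i<Suc k. c i *\<^sub>R B i)" for c
  have [measurable]: "T \<in> borel_measurable (?M (Suc k))" unfolding T_def by measurable
  have Ta: "T c \<bullet> a = 0" for c
    using comm ba by (simp add: T_def inner_add_left sumB inner_sum_left Bs)
  \<comment> \<open>The projection sends \<open>T c + t *\<^sub>R a\<close> to
    \<open>T c + t *\<^sub>R w\<close>. As \<open>w\<close> is orthogonal to \<open>a\<close>, this
    is a translation within the hyperplane and leaves the integral unchanged.\<close>
  define w where "w = a - (1 / a $ j) *\<^sub>R axis j 1"
  have wa: "w \<bullet> a = 0" unfolding w_def using aa aj by (simp add: inner_diff_left inner_axis')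
  have "(\<integral>\<^sup>+x. slab_weight a j x \<partial>lborel) = (\<integral>\<^sup>+c. slab_weight a j (\<Sum>i<Suc (Suc k). c i *\<^sub>R B i) \<partial>?M (Suc (Suc k)))"
    by (rule nn_integral_orthonormal_coordinates[OF oB N]) measurable
  also have "\<dots> = (\<integral>\<^sup>+t. (\<integral>\<^sup>+c. slab_weight a j (\<Sum>i<Suc (Suc k). (c(Suc k := t)) i *\<^sub>R B i) \<partial>?M (Suc k)) \<partial>lborel)"
    unfolding lessThan_Suc[of "Suc k"]
    by (rule lborel_prod.product_nn_integral_insert_rev) auto
  also have "\<dots> = (\<integral>\<^sup>+t. indicator {0..1::real} t * (\<integral>\<^sup>+c. orthant_weight (T c) \<partial>?M (Suc k)) \<partial>lborel)"
  proof (rule nn_integral_cong)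
    fix t :: real
    have *: "(\<Sum>i<Suc (Suc k). (c(Suc k := t)) i *\<^sub>R B i) = T c + t *\<^sub>R a" for c
      by (simp add: T_def Bs)
    have "slab_weight a j (T c + t *\<^sub>R a) = indicator {0..1} t * orthant_weight (T c + t *\<^sub>R w)" for c
      using Ta aa by (simp add: slab_weight_def inner_add_left w_def algebra_simps)
    then have "(\<integral>\<^sup>+c. slab_weight a j (\<Sum>i<Suc (Suc k). (c(Suc k := t)) i *\<^sub>R B i) \<partial>?M (Suc k))
      = indicator {0..1} t * (\<integral>\<^sup>+c. orthant_weight (T c + t *\<^sub>R w) \<partial>?M (Suc k))"
      unfolding * by (simp add: nn_integral_cmult)
    also have "(\<integral>\<^sup>+c. orthant_weight (T c + t *\<^sub>R w) \<partial>?M (Suc k)) = (\<integral>\<^sup>+c. orthant_weight (T c) \<partial>?M (Suc k))"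
    proof -
      have "T (\<lambda>i\<in>{..<Suc k}. 1 * c i + (t *\<^sub>R w) \<bullet> B i) = T c + t *\<^sub>R w" for c
      proof -
        have "T (\<lambda>i\<in>{..<Suc k}. 1 * c i + (t *\<^sub>R w) \<bullet> B i) = T c + (\<Sum>i<Suc k. ((t *\<^sub>R w) \<bullet> B i) *\<^sub>R B i)"
          unfolding T_def sum.distrib[symmetric] by (intro sum.cong) (auto simp: scaleR_add_left)
        also have "(\<Sum>i<Suc k. ((t *\<^sub>R w) \<bullet> B i) *\<^sub>R B i) = t *\<^sub>R w"
          using expand[of "t *\<^sub>R w"] wa by (simp add: Bs(3))
        finally show ?thesis .
      qed
      then show ?thesis
        using nn_integral_PiM_affine[of "{..<Suc k}" 1 "\<lambda>c. orthant_weight (T c)" "\<lambda>i. (t *\<^sub>R w) \<bullet> B i"]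
        by simp
    qed
    finally show "(\<integral>\<^sup>+c. slab_weight a j (\<Sum>i<Suc (Suc k). (c(Suc k := t)) i *\<^sub>R B i) \<partial>?M (Suc k))
      = indicator {0..1} t * (\<integral>\<^sup>+c. orthant_weight (T c) \<partial>?M (Suc k))" .
  qed
  also have "\<dots> = (\<integral>\<^sup>+c. orthant_weight (T c) \<partial>?M (Suc k))"
    by (simp add: nn_integral_multc)
  also have "\<dots> = (\<integral>\<^sup>+s. (\<integral>\<^sup>+c. orthant_weight (T (c(k := s))) \<partial>?M k) \<partial>lborel)"
    using lborel_prod.product_nn_integral_insert_rev[of "{..<k}" k "\<lambda>c. orthant_weight (T c)", folded lessThan_Suc]
    by simp
  also have "\<dots> = (\<integral>\<^sup>+s. (\<integral>\<^sup>+c. orthant_weight ((\<Sum>i<k. c i *\<^sub>R b i) + (s / r) *\<^sub>R 1) \<partial>?M k) \<partial>lborel)"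
  proof -
    have "T (c(k := s)) = (\<Sum>i<k. c i *\<^sub>R b i) + (s / r) *\<^sub>R 1" for c s
    proof -
      have "(\<Sum>i<k. (c(k := s)) i *\<^sub>R B i) = (\<Sum>i<k. c i *\<^sub>R b i)"
        by (intro sum.cong) (auto simp: Bs)
      then show ?thesis by (simp add: T_def Bs(2))
    qed
    then show ?thesis by simp
  qed
  \<comment> \<open>The substitution \<open>s = \<rho> / r\<close> makes \<open>\<rho>\<close> the
    coordinate sum of the point, since the all-ones vector has squared norm
    \<open>r * r\<close>.\<close>
  also have "\<dots> = ennreal (1 / r) * (\<integral>\<^sup>+\<rho>. (\<integral>\<^sup>+c. orthant_weight ((\<Sum>i<k. c i *\<^sub>R b i) + (\<rho> / (r * r)) *\<^sub>R 1) \<partial>?M k) \<partial>lborel)"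
  proof -
    have "(\<lambda>s. \<integral>\<^sup>+c. orthant_weight ((\<Sum>i<k. c i *\<^sub>R b i) + (s / r) *\<^sub>R 1) \<partial>?M k) \<in> borel_measurable borel"
    proof (rule sigma_finite_measure.borel_measurable_nn_integral)
      show "sigma_finite_measure (?M k)" by (rule lborel_prod.sigma_finite) simp
    qed measurable
    from nn_integral_real_affine[OF this, of "1 / r" 0] r show ?thesis by simp
  qed
  also have "(\<integral>\<^sup>+\<rho>. (\<integral>\<^sup>+c. orthant_weight ((\<Sum>i<k. c i *\<^sub>R b i) + (\<rho> / (r * r)) *\<^sub>R 1) \<partial>?M k) \<partial>lborel)
    = (\<integral>\<^sup>+\<rho>. ennreal (\<rho> ^ k) * expo \<rho> * emeasure (?M k) {c \<in> space (?M k). \<forall>l. 0 \<le> flat_point k p b c $ l} \<partial>lborel)"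
  \<comment> \<open>Both sides vanish for \<open>\<rho> < 0\<close>, and scaling by
    \<open>\<rho>\<close> applies for \<open>\<rho> > 0\<close>; the single value \<open>0\<close>
    is discarded as a null set.\<close>
  proof (rule nn_integral_cong_AE, use AE_lborel_singleton[of 0] in eventually_elim)
    fix \<rho> :: real assume "\<rho> \<noteq> 0"
    then consider "\<rho> < 0" | "\<rho> > 0" by linarith
    then show "(\<integral>\<^sup>+c. orthant_weight ((\<Sum>i<k. c i *\<^sub>R b i) + (\<rho> / (r * r)) *\<^sub>R 1) \<partial>?M k)
      = ennreal (\<rho> ^ k) * expo \<rho> * emeasure (?M k) {c \<in> space (?M k). \<forall>l. 0 \<le> flat_point k p b c $ l}"
    proof cases
      case 1
      have "orthant_weight ((\<Sum>i<k. c i *\<^sub>R b i) + (\<rho> / (r * r)) *\<^sub>R 1) = 0" for c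
      proof -
        let ?x = "(\<Sum>i<k. c i *\<^sub>R b i) + (\<rho> / (r * r)) *\<^sub>R 1"
        have "?x \<bullet> 1 = \<rho>" using b1 one r by (simp add: inner_add_left inner_sum_left)
        moreover have "?x \<bullet> 1 \<ge> 0" if "\<forall>l. 0 \<le> ?x $ l"
          unfolding inner_one_vec by (rule sum_nonneg) (use that in blast)
        ultimately have "\<not> (\<forall>l. 0 \<le> ?x $ l)" using 1 by (metis not_le)
        then show ?thesis by (simp add: orthant_weight_eq)
      qed
      then show ?thesis using 1 by (simp add: expo_def)
    next
      case 2
      \<comment> \<open>The base point \<open>p\<close> may lie off the line of the all-ones vector.
        Its frame components supply the shift \<open>\<rho> * (p \<bullet> b i)\<close> that makes
        the slice exactly \<open>\<rho>\<close> times the chosen section.\<close>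
      have pexp: "(\<Sum>i<k. (p \<bullet> b i) *\<^sub>R b i) + (1 / (r * r)) *\<^sub>R 1 = p"
        using expand[of p] pa p1 by (simp add: Bs(2,3) Bs(1) cong: sum.cong_simp)
      have [measurable]: "(\<lambda>c. orthant_weight ((\<Sum>i<k. c i *\<^sub>R b i) + (\<rho> / (r * r)) *\<^sub>R 1)) \<in> borel_measurable (?M k)"
        by measurable
      have "(\<integral>\<^sup>+c. orthant_weight ((\<Sum>i<k. c i *\<^sub>R b i) + (\<rho> / (r * r)) *\<^sub>R 1) \<partial>?M k)
        = ennreal (\<rho> ^ k) * (\<integral>\<^sup>+c. orthant_weight
            ((\<Sum>i<k. (\<lambda>i\<in>{..<k}. \<rho> * c i + \<rho> * (p \<bullet> b i)) i *\<^sub>R b i) + (\<rho> / (r * r)) *\<^sub>R 1) \<partial>?M k)"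
        using nn_integral_PiM_affine[of "{..<k}" \<rho> "\<lambda>c. orthant_weight ((\<Sum>i<k. c i *\<^sub>R b i) + (\<rho> / (r * r)) *\<^sub>R 1)"
          "\<lambda>i. \<rho> * (p \<bullet> b i)"] 2 by simp
      also have "(\<integral>\<^sup>+c. orthant_weight
            ((\<Sum>i<k. (\<lambda>i\<in>{..<k}. \<rho> * c i + \<rho> * (p \<bullet> b i)) i *\<^sub>R b i) + (\<rho> / (r * r)) *\<^sub>R 1) \<partial>?M k)
          = (\<integral>\<^sup>+c. expo \<rho> * indicator {c \<in> space (?M k). \<forall>l. 0 \<le> flat_point k p b c $ l} c \<partial>?M k)"
      proof (rule nn_integral_cong)
        fix c assume c: "c \<in> space (?M k)"
        have "(\<Sum>i<k. (\<lambda>i\<in>{..<k}. \<rho> * c i + \<rho> * (p \<bullet> b i)) i *\<^sub>R b i) + (\<rho> / (r * r)) *\<^sub>R 1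
          = \<rho> *\<^sub>R ((\<Sum>i<k. c i *\<^sub>R b i) + ((\<Sum>i<k. (p \<bullet> b i) *\<^sub>R b i) + (1 / (r * r)) *\<^sub>R 1))"
          by (simp add: scaleR_add_left scaleR_add_right sum.distrib scaleR_sum_right)
        also have "\<dots> = \<rho> *\<^sub>R flat_point k p b c" unfolding pexp by (simp add: flat_point_def add.commute)
        finally have eq: "(\<Sum>i<k. (\<lambda>i\<in>{..<k}. \<rho> * c i + \<rho> * (p \<bullet> b i)) i *\<^sub>R b i) + (\<rho> / (r * r)) *\<^sub>R 1
          = \<rho> *\<^sub>R flat_point k p b c" .
        have "flat_point k p b c \<bullet> 1 = 1" using b1 p1 by (simp add: flat_point_inner)
        then show "orthant_weight ((\<Sum>i<k. (\<lambda>i\<in>{..<k}. \<rho> * c i + \<rho> * (p \<bullet> b i)) i *\<^sub>R b i) + (\<rho> / (r * r)) *\<^sub>R 1)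
          = expo \<rho> * indicator {c \<in> space (?M k). \<forall>l. 0 \<le> flat_point k p b c $ l} c"
          unfolding eq orthant_weight_eq using 2 c by (simp add: expo_def indicator_def zero_le_mult_iff)
      qed
      also have "\<dots> = expo \<rho> * emeasure (?M k) {c \<in> space (?M k). \<forall>l. 0 \<le> flat_point k p b c $ l}"
        unfolding flat_point_def by (subst nn_integral_cmult_indicator) measurable
      finally show ?thesis by (simp add: mult.assoc)
    qed
  qed
  also have "\<dots> = ennreal (fact k) * emeasure (?M k) {c \<in> space (?M k). \<forall>l. 0 \<le> flat_point k p b c $ l}"
    by (simp add: nn_integral_multc nn_integral_power_expo)
  finally have *: "(\<integral>\<^sup>+x. slab_weight a j x \<partial>lborel) = ennreal (1 / r) *
    (ennreal (fact k) * emeasure (?M k) {c \<in> space (?M k). \<forall>l. 0 \<le> flat_point k p b c $ l})" .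
  have "ennreal (fact k / r) = ennreal (1 / r) * ennreal (fact k)"
    using r by (simp flip: ennreal_mult')
  then show ?thesis by (simp add: * r_def mult.assoc add.commute)
qed

lemma sum_density_at_0:
  fixes a :: "real ^ 'm"
  assumes N: "CARD('m) = Suc (Suc k)" and a1: "(\<Sum>i\<in>UNIV. a $ i) = 0" and aa: "(\<Sum>i\<in>UNIV. (a $ i)\<^sup>2) = 1"
    and aj: "a $ j \<noteq> 0"
  shows "sum_density (($) a) j (UNIV - {j}) 0 = ennreal (fact k / sqrt (k + 2)) * vol k (regular_simplex \<inter> perp a)"
proof -
  have a: "a \<bullet> 1 = 0" "a \<bullet> a = 1"
    using a1 aa by (auto simp: inner_one_vec) (simp add: inner_vec_def power2_eq_square)
  show ?thesis
  proof (rule simplex_section_frame[OF N a])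
    fix p b
    assume pb: "orthonormal_family k b" "\<And>i. i < k \<Longrightarrow> b i \<bullet> a = 0" "\<And>i. i < k \<Longrightarrow> b i \<bullet> 1 = 0"
      "p \<bullet> a = 0" "p \<bullet> 1 = 1"
    assume vol: "vol k (regular_simplex \<inter> perp a) = emeasure (PiM {..<k} (\<lambda>_. lborel))
       {c \<in> space (PiM {..<k} (\<lambda>_. lborel)). \<forall>l. 0 \<le> flat_point k p b c $ l}"
    show ?thesis
      unfolding vol nn_integral_slab_weight_coordinates[OF aj, symmetric]
      by (rule nn_integral_slab_weight_frame[OF N pb a aj])
  qed
qed

subsection \<open>Extremal sections\<close>

text \<open>The common form with which the volume equality, the vertex condition and the permutation
  condition are each compared. The sign of \<open>a\<close> is absorbed by exchanging
  \<open>i\<close> and \<open>j\<close>.\<close>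

definition edge_direction :: "real ^ 'm \<Rightarrow> bool" where
  "edge_direction a \<longleftrightarrow> (\<exists>i j. i \<noteq> j \<and> a $ i = 1 / sqrt 2 \<and> a $ j = - (1 / sqrt 2) \<and>
     (\<forall>l. l \<noteq> i \<longrightarrow> l \<noteq> j \<longrightarrow> a $ l = 0))"

lemma edge_direction_if_two_nonzero:
  fixes a :: "real ^ 'm"
  assumes ij: "i \<noteq> j" and zero: "\<And>l. l \<noteq> i \<Longrightarrow> l \<noteq> j \<Longrightarrow> a $ l = 0"
    and sum0: "(\<Sum>l\<in>UNIV. a $ l) = 0" and sum1: "(\<Sum>l\<in>UNIV. (a $ l)\<^sup>2) = 1"
  shows "edge_direction a"
proof -
  have "(\<Sum>l\<in>UNIV. a $ l) = (\<Sum>l\<in>{i, j}. a $ l)" "(\<Sum>l\<in>UNIV. (a $ l)\<^sup>2) = (\<Sum>l\<in>{i, j}. (a $ l)\<^sup>2)"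
    by (rule sum.mono_neutral_right; use zero in force)+
  then have s: "a $ i + a $ j = 0" "(a $ i)\<^sup>2 + (a $ j)\<^sup>2 = 1" using sum0 sum1 ij by auto
  then have aj: "a $ j = - a $ i" by simp
  then have "(a $ i)\<^sup>2 = (1 / sqrt 2)\<^sup>2" using s(2) by (simp add: power_divide)
  then have "a $ i = 1 / sqrt 2 \<or> a $ i = - (1 / sqrt 2)" by (simp only: power2_eq_iff)
  then show ?thesis
  proof
    assume "a $ i = 1 / sqrt 2"
    then show ?thesis unfolding edge_direction_def using aj ij zero by (intro exI[of _ i] exI[of _ j]) auto
  next
    assume "a $ i = - (1 / sqrt 2)"
    then show ?thesis unfolding edge_direction_def using aj ij zero by (intro exI[of _ j] exI[of _ i]) auto
  qed
qed

lemma ex_pos_neg_coordinate: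
  fixes a :: "real ^ 'm"
  assumes "(\<Sum>l\<in>UNIV. a $ l) = 0" "(\<Sum>l\<in>UNIV. (a $ l)\<^sup>2) = 1"
  shows "\<exists>i. a $ i > 0" "\<exists>i. a $ i < 0"
proof -
  have *: "\<exists>i. b $ i > 0" if "(\<Sum>l\<in>UNIV. b $ l) = 0" "(\<Sum>l\<in>UNIV. (b $ l)\<^sup>2) = 1" for b :: "real ^ 'm"
  proof (rule ccontr)
    assume "\<not> (\<exists>i. b $ i > 0)"
    then have "- b $ i \<ge> 0" for i by (simp add: not_less)
    moreover have "(\<Sum>l\<in>UNIV. - b $ l) = 0" using that(1) by (simp add: sum_negf)
    ultimately have "b $ i = 0" for i by (simp add: sum_nonneg_eq_0_iff)
    then show False using that(2) by simp
  qed
  show "\<exists>i. a $ i > 0" using *[of a] assms by simp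
  show "\<exists>i. a $ i < 0" using *[of "- a"] assms by (simp add: sum_negf)
qed

context
  fixes a :: "real ^ 'm" and k :: nat
  assumes N: "CARD('m) = Suc (Suc k)"
    and sum0: "(\<Sum>l\<in>UNIV. a $ l) = 0" and sum1: "(\<Sum>l\<in>UNIV. (a $ l)\<^sup>2) = 1"
begin

lemma section_volume_density:
  assumes "a $ j \<noteq> 0"
  shows "vol k (regular_simplex \<inter> perp a) = ennreal (sqrt (k + 2) / fact k) * sum_density (($) a) j (UNIV - {j}) 0"
proof -
  have "ennreal (sqrt (k + 2) / fact k) * ennreal (fact k / sqrt (k + 2)) = 1"
    by (simp add: add_nonneg_eq_0_iff flip: ennreal_mult)
  then show ?thesis
    unfolding sum_density_at_0[OF N sum0 sum1 assms] by (simp flip: mult.assoc)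
qed

lemma section_volume_le:
  "vol k (regular_simplex \<inter> perp a) \<le> ennreal (sqrt (k + 2) / fact k) * ennreal (1 / sqrt 2)"
proof -
  obtain j where "a $ j < 0" using ex_pos_neg_coordinate[OF sum0 sum1] by blast
  then show ?thesis
    using sum0 sum1 by (subst section_volume_density[of j]) (auto intro!: mult_left_mono sum_density_le)
qed

lemma section_volume_eq:
  assumes "edge_direction a"
  shows "vol k (regular_simplex \<inter> perp a) = ennreal (sqrt (k + 2) / fact k) * ennreal (1 / sqrt 2)"
proof -
  obtain i j where ij: "i \<noteq> j" "a $ i = 1 / sqrt 2" "a $ j = - (1 / sqrt 2)" "\<And>l. l \<noteq> i \<Longrightarrow> l \<noteq> j \<Longrightarrow> a $ l = 0"
    using assms unfolding edge_direction_def by blast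
  then have aj: "a $ j \<noteq> 0" by simp
  have "sum_density (($) a) j (UNIV - {j}) 0 = ennreal (1 / sqrt 2)"
    by (rule sum_density_eq[OF _ _ aj sum0 sum1 _ ij(2,3)]) (use ij(4) in auto)
  then show ?thesis by (simp only: section_volume_density[OF aj])
qed

lemma section_volume_less:
  assumes "a $ i > 0" "a $ l > 0" "i \<noteq> l"
  shows "vol k (regular_simplex \<inter> perp a) < ennreal (sqrt (k + 2) / fact k) * ennreal (1 / sqrt 2)"
proof -
  obtain j where j: "a $ j < 0" using ex_pos_neg_coordinate[OF sum0 sum1] by blast
  then have "sum_density (($) a) j (UNIV - {j}) 0 < ennreal (1 / sqrt 2)"
    using assms sum0 sum1 by (intro sum_density_less[of UNIV j _ i l]) auto
  then have "ennreal (sqrt (k + 2) / fact k) * sum_density (($) a) j (UNIV - {j}) 0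
      < ennreal (sqrt (k + 2) / fact k) * ennreal (1 / sqrt 2)"
    by (intro ennreal_mult_strict_left_mono) (auto simp: zero_less_divide_iff add_nonneg_eq_0_iff)
  then show ?thesis using j by (subst section_volume_density[of j]) auto
qed

end

lemma section_volume_eq_iff:
  fixes a :: "real ^ 'm"
  assumes N: "CARD('m) = Suc (Suc k)"
    and sum0: "(\<Sum>l\<in>UNIV. a $ l) = 0" and sum1: "(\<Sum>l\<in>UNIV. (a $ l)\<^sup>2) = 1"
  shows "vol k (regular_simplex \<inter> perp a) = ennreal (sqrt (k + 2) / fact k) * ennreal (1 / sqrt 2)
    \<longleftrightarrow> edge_direction a" (is "?v = ?b \<longleftrightarrow> _")
proof
  assume eq: "?v = ?b"
  have m: "(\<Sum>l\<in>UNIV. (- a) $ l) = 0" "(\<Sum>l\<in>UNIV. ((- a) $ l)\<^sup>2) = 1"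
    using sum0 sum1 by (simp_all add: sum_negf)
  have "perp (- a) = perp a" by (simp add: perp_def)
  then have less: "\<not> ?v < ?b \<Longrightarrow> a $ i < 0 \<Longrightarrow> a $ l < 0 \<Longrightarrow> i = l" for i l
    using section_volume_less[OF N m, of i l] by auto
  obtain i j where ij: "a $ i > 0" "a $ j < 0" using ex_pos_neg_coordinate[OF sum0 sum1] by blast
  have "a $ l = 0" if "l \<noteq> i" "l \<noteq> j" for l
    using that section_volume_less[OF N sum0 sum1, of l i] less[of l j] eq ij
    by (metis less_irrefl linorder_neqE_linordered_idom)
  moreover have "i \<noteq> j" using ij by auto
  ultimately show "edge_direction a" using sum0 sum1 by (intro edge_direction_if_two_nonzero)
qed (rule section_volume_eq[OF assms])

text \<open>A vertex \<open>axis l 1\<close> lies in \<open>perp a\<close> exactly when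
  \<open>a $ l = 0\<close>, so \<open>k\<close> such vertices leave two indices for the support of
  \<open>a\<close>, and the normalisations fix the values there. For \<open>k = 0\<close> the set of
  vertices is empty.\<close>

lemma vertices_in_perp_iff:
  fixes a :: "real ^ 'm"
  assumes N: "CARD('m) = Suc (Suc k)"
    and sum0: "(\<Sum>l\<in>UNIV. a $ l) = 0" and sum1: "(\<Sum>l\<in>UNIV. (a $ l)\<^sup>2) = 1"
  shows "(\<exists>V \<subseteq> regular_simplex_vertices. card V = k \<and> V \<subseteq> perp a) \<longleftrightarrow> edge_direction a"
proof
  assume "\<exists>V \<subseteq> regular_simplex_vertices. card V = k \<and> V \<subseteq> perp a"
  then obtain V where V: "V \<subseteq> range (\<lambda>j. axis j 1 :: real ^ 'm)" "card V = k" "V \<subseteq> perp a"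
    unfolding regular_simplex_vertices_def by blast
  obtain W where W: "V = (\<lambda>j. axis j 1) ` W" using V(1) by (auto simp: subset_image_iff)
  have inj: "inj_on (\<lambda>j. axis j 1 :: real ^ 'm) W" by (auto simp: inj_on_def axis_eq_axis)
  have "card W = k" using V(2) unfolding W by (simp add: card_image[OF inj])
  then have "card (- W) = 2" using N by (simp add: Compl_eq_Diff_UNIV card_Diff_subset)
  then obtain i j where ij: "- W = {i, j}" "i \<noteq> j" by (auto simp: card_2_iff)
  have "a $ l = 0" if "l \<noteq> i" "l \<noteq> j" for l
  proof -
    have "l \<in> W" using that ij by auto
    then have "axis l 1 \<in> perp a" using V(3) W by auto
    then show ?thesis by (simp add: perp_def inner_axis')
  qed
  with ij(2) sum0 sum1 show "edge_direction a" by (intro edge_direction_if_two_nonzero)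
next
  assume "edge_direction a"
  then obtain i j where ij: "i \<noteq> j" "\<And>l. l \<noteq> i \<Longrightarrow> l \<noteq> j \<Longrightarrow> a $ l = 0"
    unfolding edge_direction_def by blast
  let ?V = "(\<lambda>j. axis j 1 :: real ^ 'm) ` (UNIV - {i, j})"
  have "inj_on (\<lambda>j. axis j 1 :: real ^ 'm) (UNIV - {i, j})" by (auto simp: inj_on_def axis_eq_axis)
  then have "card ?V = k" using N ij(1) by (simp add: card_image card_Diff_subset)
  moreover have "?V \<subseteq> perp a" using ij(2) by (auto simp: perp_def inner_axis')
  ultimately show "\<exists>V \<subseteq> regular_simplex_vertices. card V = k \<and> V \<subseteq> perp a"
    unfolding regular_simplex_vertices_def by (intro exI[of _ ?V]) auto
qed

text \<open>From left to right the zero pattern leaves two coordinates, whose values the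
  normalisations of \<open>a\<close> determine. From right to left \<open>c = 1\<close> is a
  witness, because \<open>i\<close> is taken to be the index of the positive coordinate.\<close>

lemma permuted_edge_iff:
  fixes a :: "real ^ 'm"
  assumes N: "CARD('m) = n + 1" and n: "n \<ge> 1"
    and sum0: "(\<Sum>l\<in>UNIV. a $ l) = 0" and sum1: "(\<Sum>l\<in>UNIV. (a $ l)\<^sup>2) = 1"
  shows "(\<exists>c \<sigma>. bij_betw \<sigma> {1..n + 1} (UNIV :: 'm set) \<and>
      (\<forall>j\<in>{1..n + 1}. a $ \<sigma> j = c * (1 / sqrt 2 * (if j = 1 then 1 else if j = 2 then - 1 else 0))))
    \<longleftrightarrow> edge_direction a"
proof
  assume "\<exists>c \<sigma>. bij_betw \<sigma> {1..n + 1} (UNIV :: 'm set) \<and>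
      (\<forall>j\<in>{1..n + 1}. a $ \<sigma> j = c * (1 / sqrt 2 * (if j = 1 then 1 else if j = 2 then - 1 else 0)))"
  then obtain c \<sigma> where \<sigma>: "bij_betw \<sigma> {1..n + 1} (UNIV :: 'm set)"
    and a: "\<And>j. j \<in> {1..n + 1} \<Longrightarrow> a $ \<sigma> j = c * (1 / sqrt 2 * (if j = 1 then 1 else if j = 2 then - 1 else 0))"
    by blast
  have "\<sigma> 1 \<noteq> \<sigma> 2"
    using \<sigma> n inj_onD[of \<sigma> "{1..n + 1}" 1 2] by (auto simp: bij_betw_def)
  moreover have "a $ l = 0" if "l \<noteq> \<sigma> 1" "l \<noteq> \<sigma> 2" for l
  proof -
    have "l \<in> \<sigma> ` {1..n + 1}" using \<sigma> by (simp add: bij_betw_def)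
    then obtain j where "j \<in> {1..n + 1}" "l = \<sigma> j" by blast
    then show ?thesis using a[of j] that by auto
  qed
  ultimately show "edge_direction a" using sum0 sum1 by (intro edge_direction_if_two_nonzero)
next
  assume "edge_direction a"
  then obtain i j where ij: "i \<noteq> j" "a $ i = 1 / sqrt 2" "a $ j = - (1 / sqrt 2)" "\<And>l. l \<noteq> i \<Longrightarrow> l \<noteq> j \<Longrightarrow> a $ l = 0"
    unfolding edge_direction_def by blast
  have "card {3..n + 1} = card (UNIV - {i, j})"
    using N ij(1) by (simp add: card_Diff_subset)
  then obtain g where g: "bij_betw g {3..n + 1} (UNIV - {i, j})"
    using finite_same_card_bij[of "{3..n + 1}" "UNIV - {i, j}"] by auto
  \<comment> \<open>The special positions \<open>1\<close> and \<open>2\<close> go to the support of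
    \<open>a\<close>; \<open>g\<close> matches the remaining positions with the indices of zero
    coordinates.\<close>
  define \<sigma> where "\<sigma> x = (if x = 1 then i else if x = 2 then j else g x)" for x :: nat
  have "bij_betw \<sigma> {3..n + 1} (UNIV - {i, j})"
    using g by (rule bij_betw_cong[THEN iffD1, rotated]) (auto simp: \<sigma>_def)
  moreover have "bij_betw \<sigma> {1, 2} {i, j}" using ij(1) by (auto simp: \<sigma>_def bij_betw_def inj_on_def)
  ultimately have "bij_betw \<sigma> ({1, 2} \<union> {3..n + 1}) ({i, j} \<union> (UNIV - {i, j}))"
    by (intro bij_betw_combine) auto
  moreover have "{1, 2} \<union> {3..n + 1} = {1..n + 1}" using n by auto
  ultimately have \<sigma>: "bij_betw \<sigma> {1..n + 1} UNIV" by simp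
  have "a $ \<sigma> x = 1 * (1 / sqrt 2 * (if x = 1 then 1 else if x = 2 then - 1 else 0))" if "x \<in> {1..n + 1}" for x
  proof -
    have "g x \<noteq> i \<and> g x \<noteq> j" if "x \<noteq> 1" "x \<noteq> 2"
      using bij_betwE[OF g] that \<open>x \<in> {1..n + 1}\<close> by force
    then show ?thesis using ij by (auto simp: \<sigma>_def)
  qed
  with \<sigma> show "\<exists>c \<sigma>. bij_betw \<sigma> {1..n + 1} (UNIV :: 'm set) \<and>
      (\<forall>j\<in>{1..n + 1}. a $ \<sigma> j = c * (1 / sqrt 2 * (if j = 1 then 1 else if j = 2 then - 1 else 0)))"
    by blast
qed

theorem corollary3p6:
  fixes n :: nat and a :: "real ^ 'm"
  assumes "n \<ge> 1"
    and "CARD('m) = n + 1"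
    and "(\<Sum>j\<in>UNIV. a $ j) = 0"
    and "(\<Sum>j\<in>UNIV. (a $ j)\<^sup>2) = 1"
  shows "let v = vol (n - 1) (regular_simplex \<inter> perp a);
             bound = ennreal (sqrt (real (n + 1)) / fact (n - 1) * (1 / sqrt 2))
         in v \<le> bound \<and>
            (v = bound \<longleftrightarrow>
              (\<exists>V \<subseteq> regular_simplex_vertices. card V = n - 1 \<and> V \<subseteq> perp a)) \<and>
            (v = bound \<longleftrightarrow>
              (\<exists>c \<sigma>. bij_betw \<sigma> {1..n + 1} (UNIV :: 'm set) \<and>
                (\<forall>j\<in>{1..n + 1}. a $ \<sigma> j =
                   c * (1 / sqrt 2 * (if j = 1 then 1 else if j = 2 then - 1 else 0)))))"
proof -
  obtain k where k: "n = Suc k" using assms(1) by (cases n) auto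
  have N: "CARD('m) = Suc (Suc k)" using assms(2) k by simp
  have b: "ennreal (sqrt (real (n + 1)) / fact (n - 1) * (1 / sqrt 2)) = ennreal (sqrt (real (k + 2)) / fact k) * ennreal (1 / sqrt 2)"
    unfolding k by (subst ennreal_mult[symmetric]) (auto simp: add_ac)
  show ?thesis
    unfolding Let_def b permuted_edge_iff[OF assms(2,1,3,4)]
    using section_volume_le[OF N assms(3,4)] section_volume_eq_iff[OF N assms(3,4)] vertices_in_perp_iff[OF N assms(3,4)]
    by (simp add: k)
qed

end
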